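(* Let $D\ge2$ and $k\geq 1$. There exist constants $c,C'>0$ depending only on $D$ and $k$ such that the following holds. Let $E\subset\mathbb R^D$ be finite with $\mathrm{card}(E)\leq k$, let $\phi:E\to\mathbb R^D$, let $0<\varepsilon<c$ and set $\delta=\exp(-C'/\varepsilon)$. Suppose that for every $E_0\subset E$ with at most $2D+2$ points there exists a $\delta$-distorted diffeomorphism $\Phi^{E_0}:\mathbb R^D\to\mathbb R^D$ with $\Phi^{E_0}=\phi$ on $E_0$. Then there exists an $\varepsilon$-distorted diffeomorphism $\Phi:\mathbb R^D\to\mathbb R^D$ with $\Phi=\phi$ on $E$.
   Context: For $\varepsilon>0$, an $\varepsilon$-distorted diffeomorphism is a diffeomorphism $\Phi$ of $\mathbb R^D$ onto $\mathbb R^D$ with $(1+\varepsilon)^{-1}I\leq(\nabla\Phi(x))^T\nabla\Phi(x)\leq(1+\varepsilon)I$ as matrices for all $x\in\mathbb R^D$. *)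

theory Defs
  imports "HOL-Analysis.Analysis"
begin

definition loewner_le :: "real^'n^'n \<Rightarrow> real^'n^'n \<Rightarrow> bool" where
  "loewner_le A B \<longleftrightarrow> (\<forall>v::real^'n. v \<bullet> ((B - A) *v v) \<ge> 0)"

definition jacobian :: "(real^'n \<Rightarrow> real^'n) \<Rightarrow> real^'n \<Rightarrow> real^'n^'n" where
  "jacobian \<Phi> x = matrix (frechet_derivative \<Phi> (at x))"

definition C1_diffeo :: "(real^'n \<Rightarrow> real^'n) \<Rightarrow> bool" where
  "C1_diffeo \<Phi> \<longleftrightarrow> bij \<Phi>
     \<and> (\<forall>x. \<Phi> differentiable (at x)) \<and> continuous_on UNIV (jacobian \<Phi>)
     \<and> (\<forall>y. inv \<Phi> differentiable (at y)) \<and> continuous_on UNIV (jacobian (inv \<Phi>))"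

definition distorted_diffeo :: "real \<Rightarrow> (real^'n \<Rightarrow> real^'n) \<Rightarrow> bool" where
  "distorted_diffeo \<epsilon> \<Phi> \<longleftrightarrow> C1_diffeo \<Phi> \<and>
     (\<forall>x. loewner_le (mat (inverse (1 + \<epsilon>))) (transpose (jacobian \<Phi> x) ** jacobian \<Phi> x)
        \<and> loewner_le (transpose (jacobian \<Phi> x) ** jacobian \<Phi> x) (mat (1 + \<epsilon>)))"

end

(*
E is organised into clusters by huge ratios between distances. A cluster that is far from the
rest of E looks like a single point from outside, so by induction an extension is already known
that is a motion near that point. At the scale of the cluster itself phi is close to another
motion, because it is almost isometric and agrees on few points with a map of the whole space that
is; one passes from the first motion to the second by twisting slowly along a logarithmic scale,
which costs distortion epsilon only over a factor exp(C / epsilon) of scales, and then slides each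
point of the cluster into place. The twist exists only between motions of the same orientation.
A spanner of D + 1 points detects the orientations that a cluster admits, so extendability from
2 D + 2 points makes a common orientation for all clusters possible.
*)

theory Submission
  imports Defs
begin

section \<open>Logarithmic cutoff functions\<close>

text \<open>The size of \<delta> comes from a competition of scales. A twist needs a range of scales
  of ratio about exp b with b of order 1 / \<eta>. An empty range of that length is found only by
  pigeonhole among k candidates, so the diameter of a cluster may be about (32 * exp b)^k times its
  smallest distance m. The slides tolerate errors of order \<eta> * m only, while rigidity yields an
  error of order \<delta>^(1/4) times the diameter. This is affordable once \<delta> is exp (- C' /
  \<epsilon>) with C' large enough. All corrections are made by precomposition. In a ball where the
  coarser extension is an exact motion, changing the argument changes the motion; in the transition
  shell the coarser extension enters only through its distortion bound. For the recursion to
  continue, each stage must again be an exact motion near every point, up to a radius comparable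
  with the distance to its nearest neighbour.\<close>

definition smooth_step :: "real \<Rightarrow> real" where
  "smooth_step t = 2 * (max 0 t)\<^sup>2 - 4 * (max 0 (t - 1/2))\<^sup>2 + 2 * (max 0 (t - 1))\<^sup>2"

text \<open>The tent of height 2 and area 1 over the unit interval. A piecewise quadratic step is
  smooth enough because \<open>C1_diffeo\<close> asks for continuous first derivatives only.\<close>

definition smooth_step' :: "real \<Rightarrow> real" where
  "smooth_step' t = 4 * max 0 t - 8 * max 0 (t - 1/2) + 4 * max 0 (t - 1)"

lemma has_real_derivative_max_0_squared:
  "((\<lambda>t::real. (max 0 t)\<^sup>2) has_real_derivative 2 * max 0 t) (at t)"
proof -
  consider "t > 0" | "t < 0" | "t = 0" by linarith
  then show ?thesis
  proof cases
    case 1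
    have "((\<lambda>t::real. t\<^sup>2) has_real_derivative 2 * max 0 t) (at t)"
      using 1 by (auto intro!: derivative_eq_intros)
    moreover have "\<forall>\<^sub>F s in nhds t. (max 0 s)\<^sup>2 = s\<^sup>2"
      using eventually_nhds_in_open[of "{0<..}" t] 1
      by (auto elim!: eventually_mono)
    ultimately show ?thesis
      by (subst DERIV_cong_ev[OF refl _ refl]) auto
  next
    case 2
    have "((\<lambda>t::real. 0) has_real_derivative 2 * max 0 t) (at t)"
      using 2 by auto
    moreover have "\<forall>\<^sub>F s in nhds t. (max 0 s)\<^sup>2 = 0"
      using eventually_nhds_in_open[of "{..<0}" t] 2
      by (auto elim!: eventually_mono)
    ultimately show ?thesis
      by (subst DERIV_cong_ev[OF refl _ refl]) auto
  next
    case 3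
    \<comment> \<open>At the kink the difference quotient is \<open>max 0\<close> itself; for
      \<open>h = 0\<close> both sides are 0 by the convention on division.\<close>
    have "(\<lambda>h::real. (max 0 (0 + h))\<^sup>2 / h) = max 0"
      by (auto simp: fun_eq_iff power2_eq_square max_def)
    moreover have "(max 0 \<longlongrightarrow> (0::real)) (at 0)"
      using tendsto_max[OF tendsto_const[of 0] tendsto_ident_at[of 0 UNIV]] by simp
    ultimately show ?thesis
      using 3 by (simp add: DERIV_def)
  qed
qed

lemma has_real_derivative_smooth_step:
  "(smooth_step has_real_derivative smooth_step' t) (at t)"
proof -
  have *: "((\<lambda>t::real. (max 0 (t - a))\<^sup>2) has_real_derivative 2 * max 0 (t - a)) (at t)" for a
  proof -
    have "((\<lambda>t. t - a) has_real_derivative 1) (at t)"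
      by (auto intro!: derivative_eq_intros)
    from DERIV_chain2[OF has_real_derivative_max_0_squared this] show ?thesis by simp
  qed
  show ?thesis
    unfolding smooth_step_def[abs_def] smooth_step'_def
    by (rule derivative_eq_intros *[of "1/2"] *[of 1] has_real_derivative_max_0_squared refl | simp)+
qed

lemma abs_smooth_step'_le: "\<bar>smooth_step' t\<bar> \<le> 2"
  by (auto simp: smooth_step'_def max_def)

lemma continuous_on_smooth_step' [continuous_intros]:
  "continuous_on A f \<Longrightarrow> continuous_on A (\<lambda>x. smooth_step' (f x))"
  unfolding smooth_step'_def by (intro continuous_intros)

lemma smooth_step_eq_0: "t \<le> 0 \<Longrightarrow> smooth_step t = 0"
  by (simp add: smooth_step_def)

lemma smooth_step_eq_1: "t \<ge> 1 \<Longrightarrow> smooth_step t = 1"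
  by (simp add: smooth_step_def power2_eq_square algebra_simps)

text \<open>The logarithm makes the derivative of the cutoff decay like \<open>1 / (b * norm x)\<close>:
  this is what makes a twist over a long range of scales almost isometric.\<close>

definition log_cutoff :: "real \<Rightarrow> real \<Rightarrow> 'a::real_inner \<Rightarrow> real" where
  "log_cutoff \<rho> b x = smooth_step ((b + ln (2 * \<rho>\<^sup>2) - ln (\<rho>\<^sup>2 + x \<bullet> x)) / b)"

definition log_cutoff' :: "real \<Rightarrow> real \<Rightarrow> 'a::real_inner \<Rightarrow> 'a \<Rightarrow> real" where
  "log_cutoff' \<rho> b x v =
     - smooth_step' ((b + ln (2 * \<rho>\<^sup>2) - ln (\<rho>\<^sup>2 + x \<bullet> x)) / b) * (2 * (x \<bullet> v) / (b * (\<rho>\<^sup>2 + x \<bullet> x)))"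

lemma cutoff_denominator_pos: "\<rho> > 0 \<Longrightarrow> \<rho>\<^sup>2 + x \<bullet> x > 0" for \<rho> :: real
  by (simp add: add_pos_nonneg)

lemma has_derivative_log_cutoff:
  assumes "\<rho> > 0" "b > 0"
  shows "(log_cutoff \<rho> b has_derivative log_cutoff' \<rho> b x) (at x)"
proof -
  note pos = cutoff_denominator_pos[OF assms(1), of x]
  have "((\<lambda>x. (b + ln (2 * \<rho>\<^sup>2) - ln (\<rho>\<^sup>2 + x \<bullet> x)) / b) has_derivative
         (\<lambda>v. - (2 * (x \<bullet> v) / (b * (\<rho>\<^sup>2 + x \<bullet> x))))) (at x)"
    using pos assms
    by (auto intro!: derivative_eq_intros ext simp: inner_commute divide_inverse mult_ac)
  from has_derivative_compose[OF this has_real_derivative_smooth_step[unfolded has_field_derivative_def]]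
  show ?thesis
    unfolding log_cutoff_def[abs_def] log_cutoff'_def[abs_def] by simp
qed

lemma continuous_on_log_cutoff':
  assumes "\<rho> > 0" "b > 0"
  shows "continuous_on UNIV (\<lambda>x. log_cutoff' \<rho> b x v)"
proof -
  have "\<rho>\<^sup>2 + x \<bullet> x \<noteq> 0" for x :: 'a
    using cutoff_denominator_pos[OF assms(1), of x] by simp
  then show ?thesis
    unfolding log_cutoff'_def using assms by (intro continuous_intros) auto
qed

text \<open>The two bounds serve the two uses of the cutoff. A slide moves points by a fixed vector,
  so the derivative is compared with 1 / \<rho>. A twist moves x by an amount proportional to
  \<open>norm x\<close>, so the product with \<open>norm x\<close> must be bounded independently of
  the scale.\<close>

lemma abs_log_cutoff'_le:
  assumes "\<rho> > 0" "b > 0"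
  shows "\<bar>log_cutoff' \<rho> b x v\<bar> \<le> 2 / (b * \<rho>) * norm v"
    and "\<bar>log_cutoff' \<rho> b x v\<bar> * norm x \<le> 4 / b * norm v"
proof -
  let ?d = "\<rho>\<^sup>2 + x \<bullet> x"
  note pos = cutoff_denominator_pos[OF assms(1), of x]
  have "\<bar>log_cutoff' \<rho> b x v\<bar> \<le> 2 * (2 * (norm x * norm v) / (b * ?d))"
    unfolding log_cutoff'_def abs_mult abs_minus abs_divide
    using abs_smooth_step'_le Cauchy_Schwarz_ineq2[of x v] pos assms
    by (intro mult_mono frac_le) auto
  also have eq: "\<dots> = (4 * norm x / ?d) * norm v / b" by (simp add: mult_ac)
  finally have *: "\<bar>log_cutoff' \<rho> b x v\<bar> \<le> (4 * norm x / ?d) * norm v / b" .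
  have "0 \<le> (\<rho> - norm x)\<^sup>2" by simp
  then have "2 * norm x * \<rho> \<le> ?d"
    by (simp add: power2_diff dot_square_norm algebra_simps)
  then have "4 * norm x / ?d \<le> 2 / \<rho>"
    using pos assms by (simp add: field_simps)
  then have "(4 * norm x / ?d) * norm v / b \<le> 2 / \<rho> * norm v / b"
    using assms by (intro divide_right_mono mult_right_mono) auto
  with * show "\<bar>log_cutoff' \<rho> b x v\<bar> \<le> 2 / (b * \<rho>) * norm v" by (simp add: field_simps)
  have "norm x * norm x \<le> ?d"
    by (simp add: dot_square_norm power2_eq_square)
  then have "4 * norm x / ?d * norm x \<le> 4"
    using pos by (simp add: field_simps)
  then have "(4 * norm x / ?d * norm x) * norm v / b \<le> 4 * norm v / b"
    using assms by (intro divide_right_mono mult_right_mono) auto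
  moreover have "\<bar>log_cutoff' \<rho> b x v\<bar> * norm x \<le> (4 * norm x / ?d) * norm v / b * norm x"
    using * by (intro mult_right_mono) auto
  ultimately show "\<bar>log_cutoff' \<rho> b x v\<bar> * norm x \<le> 4 / b * norm v"
    by (simp add: mult_ac)
qed

text \<open>Having \<open>\<rho>\<^sup>2 + x \<bullet> x\<close> under the logarithm keeps the
  cutoff differentiable at the origin; the shift by \<open>ln (2 * \<rho>\<^sup>2)\<close> puts the
  edge of the plateau exactly at radius \<rho>.\<close>

lemma log_cutoff_eq_1:
  assumes "\<rho> > 0" "b > 0" "norm x \<le> \<rho>"
  shows "log_cutoff \<rho> b x = 1"
proof -
  have "x \<bullet> x \<le> \<rho>\<^sup>2"
    using assms by (simp add: dot_square_norm)
  then have "ln (\<rho>\<^sup>2 + x \<bullet> x) \<le> ln (2 * \<rho>\<^sup>2)"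
    using cutoff_denominator_pos[OF assms(1), of x] assms by (subst ln_le_cancel_iff) auto
  then show ?thesis
    unfolding log_cutoff_def using assms by (intro smooth_step_eq_1) (simp add: field_simps)
qed

lemma log_cutoff_eq_0:
  assumes "\<rho> > 0" "b > 0" "2 * exp b * \<rho>\<^sup>2 \<le> (norm x)\<^sup>2"
  shows "log_cutoff \<rho> b x = 0"
proof -
  have "b + ln (2 * \<rho>\<^sup>2) = ln (exp b * (2 * \<rho>\<^sup>2))"
    using assms by (subst ln_mult) auto
  also have "\<dots> \<le> ln (\<rho>\<^sup>2 + x \<bullet> x)"
    using assms by (subst ln_le_cancel_iff) (auto simp: dot_square_norm add_pos_nonneg intro: add_increasing)
  finally show ?thesis
    unfolding log_cutoff_def using assms by (intro smooth_step_eq_0) (simp add: field_simps)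
qed

section \<open>Almost isometric diffeomorphisms\<close>

text \<open>A working form of \<open>distorted_diffeo\<close>, with K in place of 1 + \<epsilon> so
  that constants multiply under composition. Continuity of the derivative is stated vector by
  vector, and regularity of the inverse is recovered from the lower bound.\<close>

definition almost_isometric_diffeo :: "real \<Rightarrow> (real^'n \<Rightarrow> real^'n) \<Rightarrow> bool" where
  "almost_isometric_diffeo K \<Phi> \<longleftrightarrow> bij \<Phi> \<and>
     (\<exists>F. (\<forall>x. (\<Phi> has_derivative F x) (at x)) \<and> (\<forall>v. continuous_on UNIV (\<lambda>x. F x v)) \<and>
          (\<forall>x v. (norm v)\<^sup>2 \<le> K * (norm (F x v))\<^sup>2 \<and> (norm (F x v))\<^sup>2 \<le> K * (norm v)\<^sup>2))"

lemma loewner_le_iff_norm: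
  fixes J :: "real^'n^'n"
  shows "loewner_le (mat c) (transpose J ** J) \<longleftrightarrow> (\<forall>v. c * (norm v)\<^sup>2 \<le> (norm (J *v v))\<^sup>2)"
    and "loewner_le (transpose J ** J) (mat c) \<longleftrightarrow> (\<forall>v. (norm (J *v v))\<^sup>2 \<le> c * (norm v)\<^sup>2)"
proof -
  have *: "v \<bullet> ((transpose J ** J) *v v) = (norm (J *v v))\<^sup>2" for v
    by (metis dot_lmul_matrix matrix_vector_mul_assoc power2_norm_eq_inner transpose_matrix_vector
        transpose_transpose)
  have "mat c *v v = c *\<^sub>R v" for v :: "real^'n"
    by (simp add: vec_eq_iff matrix_vector_mult_def mat_def if_distrib[of "\<lambda>x. x * _"] cong: if_cong)
  then have **: "v \<bullet> (mat c *v v) = c * (norm v)\<^sup>2" for v :: "real^'n"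
    by (simp add: power2_norm_eq_inner)
  show "loewner_le (mat c) (transpose J ** J) \<longleftrightarrow> (\<forall>v. c * (norm v)\<^sup>2 \<le> (norm (J *v v))\<^sup>2)"
    and "loewner_le (transpose J ** J) (mat c) \<longleftrightarrow> (\<forall>v. (norm (J *v v))\<^sup>2 \<le> c * (norm v)\<^sup>2)"
    unfolding loewner_le_def by (simp_all add: matrix_vector_mult_diff_rdistrib inner_diff_right * **)
qed

lemma jacobian_eq: "(\<Phi> has_derivative F) (at x) \<Longrightarrow> jacobian \<Phi> x = matrix F"
  unfolding jacobian_def by (metis frechet_derivative_at)

lemma continuous_on_matrix:
  fixes F :: "'a::topological_space \<Rightarrow> real^'n \<Rightarrow> real^'n"
  assumes "\<And>v. continuous_on UNIV (\<lambda>x. F x v)"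
  shows "continuous_on UNIV (\<lambda>x. matrix (F x))"
  unfolding matrix_def by (intro continuous_intros assms)

text \<open>The content is the regularity of the inverse. The lower bound makes every derivative
  injective, hence invertible in finite dimension, with a uniformly bounded inverse.\<close>

lemma almost_isometric_diffeo_imp_distorted:
  fixes \<Phi> :: "real^'n \<Rightarrow> real^'n"
  assumes "almost_isometric_diffeo (1 + \<epsilon>) \<Phi>" "\<epsilon> > 0"
  shows "distorted_diffeo \<epsilon> \<Phi>"
proof -
  obtain F where bij: "bij \<Phi>" and F: "\<And>x. (\<Phi> has_derivative F x) (at x)"
    and cF: "\<And>v. continuous_on UNIV (\<lambda>x. F x v)"
    and lower: "\<And>x v. (norm v)\<^sup>2 \<le> (1 + \<epsilon>) * (norm (F x v))\<^sup>2"
    and upper: "\<And>x v. (norm (F x v))\<^sup>2 \<le> (1 + \<epsilon>) * (norm v)\<^sup>2"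
    using assms(1) unfolding almost_isometric_diffeo_def by blast
  have J: "jacobian \<Phi> x = matrix (F x)" for x
    using jacobian_eq[OF F] .
  have lin: "linear (F x)" for x
    using F has_derivative_linear by blast
  have Jv: "matrix (F x) *v v = F x v" for x v
    using fun_cong[OF matrix_vector_mul(2)[OF lin]] .
  have cJ: "continuous_on UNIV (jacobian \<Phi>)"
    using continuous_on_matrix[OF cF] by (simp add: J[abs_def])
  have inj: "inj (F x)" for x
  proof (rule linear_injective_0[OF lin, THEN iffD2], safe)
    fix v assume "F x v = 0"
    then show "v = 0" using lower[of v x] by simp
  qed
  define G where "G = (\<lambda>y. inv (F (inv \<Phi> y)))"
  have G1: "G y (F (inv \<Phi> y) v) = v" for y v
    using inj unfolding G_def by simp
  have surj: "surj (F x)" for x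
    using linear_injective_imp_surjective[OF lin inj] by simp
  have G2: "F (inv \<Phi> y) (G y v) = v" for y v
    unfolding G_def by (simp add: surj surj_f_inv_f)
  have linG: "linear (G y)" for y
    unfolding G_def using inj_linear_imp_inv_linear[OF lin inj] .
  have cinv: "continuous_on UNIV (inv \<Phi>)"
  proof -
    have "continuous_on UNIV \<Phi>"
      using F has_derivative_continuous by (blast intro: continuous_at_imp_continuous_on)
    \<comment> \<open>Invariance of domain.\<close>
    then have "continuous_on (\<Phi> ` UNIV) (inv \<Phi>)"
      using bij by (intro continuous_on_inverse_open) (auto simp: bij_is_inj)
    then show ?thesis using bij by (simp add: bij_is_surj)
  qed
  have dinv: "(inv \<Phi> has_derivative G y) (at y)" for y
  proof (rule has_derivative_inverse_basic[OF F, where T = UNIV])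
    show "bounded_linear (G y)" using linG by (simp add: linear_linear)
    show "G y \<circ> F (inv \<Phi> y) = id" using G1 by (auto simp: fun_eq_iff)
    show "continuous (at y) (inv \<Phi>)" using cinv by (simp add: continuous_on_eq_continuous_at)
    show "\<And>z. \<Phi> (inv \<Phi> z) = z" using bij by (simp add: bij_is_surj surj_f_inv_f)
  qed auto
  have upperG: "(norm (G y v))\<^sup>2 \<le> (1 + \<epsilon>) * (norm v)\<^sup>2" for y v
    using lower[of "G y v" "inv \<Phi> y"] by (simp add: G2)
  have cG: "continuous_on UNIV (\<lambda>y. G y v)" for v
  proof (rule continuous_at_imp_continuous_on, safe)
    fix y0
    \<comment> \<open>Continuity of G follows from that of F: the difference of the two inverses at
      v is \<open>G y\<close> applied to a difference of forward derivatives at the fixed vector u,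
      and \<open>G y\<close> is bounded uniformly in y.\<close>
    define u where "u = G y0 v"
    have bound: "norm (G y v - G y0 v) \<le> sqrt (1 + \<epsilon>) * norm (F (inv \<Phi> y0) u - F (inv \<Phi> y) u)" for y
    proof -
      have "G y v - G y0 v = G y (F (inv \<Phi> y0) u - F (inv \<Phi> y) u)"
        using linG[of y] by (simp add: linear_diff G1 G2 u_def)
      then have "(norm (G y v - G y0 v))\<^sup>2 \<le> (1 + \<epsilon>) * (norm (F (inv \<Phi> y0) u - F (inv \<Phi> y) u))\<^sup>2"
        using upperG[of y "F (inv \<Phi> y0) u - F (inv \<Phi> y) u"] by simp
      then have "(norm (G y v - G y0 v))\<^sup>2 \<le>
          (sqrt (1 + \<epsilon>) * norm (F (inv \<Phi> y0) u - F (inv \<Phi> y) u))\<^sup>2"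
        using \<open>\<epsilon> > 0\<close> by (simp add: power_mult_distrib)
      then show ?thesis
        by (rule power2_le_imp_le) (use \<open>\<epsilon> > 0\<close> in auto)
    qed
    have "continuous_on UNIV (\<lambda>y. F (inv \<Phi> y) u)"
      using continuous_on_compose2[OF cF cinv subset_UNIV] .
    then have "((\<lambda>y. F (inv \<Phi> y) u) \<longlongrightarrow> F (inv \<Phi> y0) u) (at y0)"
      by (simp add: continuous_on_def)
    then have "((\<lambda>y. sqrt (1 + \<epsilon>) * norm (F (inv \<Phi> y0) u - F (inv \<Phi> y) u)) \<longlongrightarrow>
      sqrt (1 + \<epsilon>) * norm (F (inv \<Phi> y0) u - F (inv \<Phi> y0) u)) (at y0)"
      by (intro tendsto_intros)
    then have lim: "((\<lambda>y. sqrt (1 + \<epsilon>) * norm (F (inv \<Phi> y0) u - F (inv \<Phi> y) u)) \<longlongrightarrow> 0) (at y0)"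
      by simp
    have "((\<lambda>y. G y v - G y0 v) \<longlongrightarrow> 0) (at y0)"
      by (rule Lim_null_comparison[OF always_eventually[OF allI[OF bound]] lim])
    then show "isCont (\<lambda>y. G y v) y0"
      unfolding isCont_def by (rule LIM_zero_cancel)
  qed
  have "jacobian (inv \<Phi>) y = matrix (G y)" for y
    using jacobian_eq[OF dinv] .
  then have cJG: "continuous_on UNIV (jacobian (inv \<Phi>))"
    using continuous_on_matrix[OF cG] by presburger
  have "inverse (1 + \<epsilon>) * (norm v)\<^sup>2 \<le> (norm (F x v))\<^sup>2" for x v
    using lower[of v x] \<open>\<epsilon> > 0\<close> by (simp add: field_simps)
  then have "loewner_le (mat (inverse (1 + \<epsilon>))) (transpose (jacobian \<Phi> x) ** jacobian \<Phi> x)"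
    and "loewner_le (transpose (jacobian \<Phi> x) ** jacobian \<Phi> x) (mat (1 + \<epsilon>))" for x
    unfolding loewner_le_iff_norm J Jv using upper by simp_all
  moreover have "\<Phi> differentiable (at x)" "inv \<Phi> differentiable (at x)" for x
    using differentiableI[OF F] differentiableI[OF dinv] .
  ultimately show ?thesis
    unfolding distorted_diffeo_def C1_diffeo_def using bij cJ cJG by simp
qed

lemma almost_isometric_diffeo_compose:
  fixes \<Phi> \<Psi> :: "real^'n \<Rightarrow> real^'n"
  assumes "almost_isometric_diffeo K \<Phi>" "almost_isometric_diffeo L \<Psi>" "K \<ge> 0" "L \<ge> 0"
  shows "almost_isometric_diffeo (K * L) (\<Phi> \<circ> \<Psi>)"
proof -
  obtain F where bij: "bij \<Phi>" and F: "\<And>x. (\<Phi> has_derivative F x) (at x)"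
    and cF: "\<And>v. continuous_on UNIV (\<lambda>x. F x v)"
    and lower: "\<And>x v. (norm v)\<^sup>2 \<le> K * (norm (F x v))\<^sup>2"
    and upper: "\<And>x v. (norm (F x v))\<^sup>2 \<le> K * (norm v)\<^sup>2"
    using assms(1) unfolding almost_isometric_diffeo_def by blast
  obtain G where bij': "bij \<Psi>" and G: "\<And>x. (\<Psi> has_derivative G x) (at x)"
    and cG: "\<And>v. continuous_on UNIV (\<lambda>x. G x v)"
    and lower': "\<And>x v. (norm v)\<^sup>2 \<le> L * (norm (G x v))\<^sup>2"
    and upper': "\<And>x v. (norm (G x v))\<^sup>2 \<le> L * (norm v)\<^sup>2"
    using assms(2) unfolding almost_isometric_diffeo_def by blast
  have lin: "linear (F x)" for x
    using F has_derivative_linear by blast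
  \<comment> \<open>Continuity of F is known for fixed vectors only, but in the chain rule the
    vector moves with the point; expanding it in the standard basis reduces to fixed
    vectors.\<close>
  have F_sum: "F x w = (\<Sum>i\<in>UNIV. w $ i *\<^sub>R F x (axis i 1))" for x w
    by (subst (1) basis_expansion[of w, symmetric])
      (simp add: linear_sum[OF lin] linear_scale[OF lin] scalar_mult_eq_scaleR)
  have c\<Psi>: "continuous_on UNIV \<Psi>"
    using G has_derivative_continuous by (blast intro: continuous_at_imp_continuous_on)
  have "continuous_on UNIV (\<lambda>x. F (\<Psi> x) (G x v))" for v
    by (subst F_sum) (intro continuous_intros cG continuous_on_compose2[OF cF c\<Psi>], auto)
  moreover have "((\<Phi> \<circ> \<Psi>) has_derivative (F (\<Psi> x) \<circ> G x)) (at x)" for x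
    by (rule diff_chain_at[OF G F])
  moreover have "(norm v)\<^sup>2 \<le> K * L * (norm (F (\<Psi> x) (G x v)))\<^sup>2" for x v
    using mult_left_mono[OF lower[of "G x v" "\<Psi> x"] \<open>L \<ge> 0\<close>] lower'[of v x] by (simp add: mult_ac)
  moreover have "(norm (F (\<Psi> x) (G x v)))\<^sup>2 \<le> K * L * (norm v)\<^sup>2" for x v
    using mult_left_mono[OF upper'[of x v] \<open>K \<ge> 0\<close>] upper[of "\<Psi> x" "G x v"] by (simp add: mult_ac)
  ultimately show ?thesis
    unfolding almost_isometric_diffeo_def using bij_comp[OF bij' bij]
    by (intro conjI exI[of _ "\<lambda>x. F (\<Psi> x) \<circ> G x"]) auto
qed

lemma almost_isometric_diffeo_mono:
  assumes "almost_isometric_diffeo K \<Phi>" "K \<le> L"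
  shows "almost_isometric_diffeo L \<Phi>"
proof -
  have "K * (norm v)\<^sup>2 \<le> L * (norm v)\<^sup>2" for v :: "real^'n"
    using assms(2) by (intro mult_right_mono) auto
  note KL = this
  obtain F where "bij \<Phi>" "\<And>x. (\<Phi> has_derivative F x) (at x)" "\<And>v. continuous_on UNIV (\<lambda>x. F x v)"
    and F: "\<And>x v. (norm v)\<^sup>2 \<le> K * (norm (F x v))\<^sup>2 \<and> (norm (F x v))\<^sup>2 \<le> K * (norm v)\<^sup>2"
    using assms(1) unfolding almost_isometric_diffeo_def by blast
  moreover have "(norm v)\<^sup>2 \<le> L * (norm (F x v))\<^sup>2 \<and> (norm (F x v))\<^sup>2 \<le> L * (norm v)\<^sup>2" for x v
    using F[of v x] KL[of v] KL[of "F x v"] by linarith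
  ultimately show ?thesis
    unfolding almost_isometric_diffeo_def by blast
qed

lemma almost_isometric_diffeo_isometry:
  fixes A :: "real^'n \<Rightarrow> real^'n"
  assumes "orthogonal_transformation A"
  shows "almost_isometric_diffeo 1 (\<lambda>x. b + A (x - a))"
proof -
  have "bij ((\<lambda>x. b + x) \<circ> A \<circ> (\<lambda>x. x - a))"
    by (rule bij_comp[OF bij_diff_right bij_comp[OF orthogonal_transformation_bij[OF assms] bij_plus]])
  then have "bij (\<lambda>x. b + A (x - a))" by (simp add: o_def)
  moreover have "bounded_linear A"
    using assms by (simp add: orthogonal_transformation_linear linear_linear)
  then have "((\<lambda>x. b + A (x - a)) has_derivative A) (at x)" for x
    using has_derivative_add[OF has_derivative_const
        bounded_linear.has_derivative[OF _ has_derivative_diff[OF has_derivative_ident has_derivative_const]]]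
    by fastforce
  ultimately show ?thesis
    unfolding almost_isometric_diffeo_def
    by (intro conjI exI[of _ "\<lambda>x. A"]) (auto simp: orthogonal_transformation_norm[OF assms])
qed

text \<open>This is the only form in which the hypothesis on extensions is used. It is the mean
  value inequality for the map and for its inverse; the derivative of the inverse is bounded through
  the chain rule and the lower bound.\<close>

lemma distorted_diffeo_bilipschitz:
  fixes \<Phi> :: "real^'n \<Rightarrow> real^'n"
  assumes "distorted_diffeo \<delta> \<Phi>" "\<delta> > 0"
  shows "(norm (\<Phi> x - \<Phi> y))\<^sup>2 \<le> (1 + \<delta>) * (norm (x - y))\<^sup>2"
    and "(norm (x - y))\<^sup>2 \<le> (1 + \<delta>) * (norm (\<Phi> x - \<Phi> y))\<^sup>2"
proof -
  have bij: "bij \<Phi>" and d: "\<And>x. \<Phi> differentiable (at x)" and d': "\<And>y. inv \<Phi> differentiable (at y)"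
    using assms unfolding distorted_diffeo_def C1_diffeo_def by auto
  define F where "F = (\<lambda>x. frechet_derivative \<Phi> (at x))"
  define G where "G = (\<lambda>x. frechet_derivative (inv \<Phi>) (at x))"
  have F: "(\<Phi> has_derivative F x) (at x)" and G: "(inv \<Phi> has_derivative G x) (at x)" for x
    using d d' unfolding F_def G_def by (auto simp: frechet_derivative_works)
  have Jv: "jacobian \<Phi> x *v v = F x v" for x v
    unfolding jacobian_eq[OF F] using fun_cong[OF matrix_vector_mul(2)[OF has_derivative_linear[OF F]]] .
  have upper: "(norm (F x v))\<^sup>2 \<le> (1 + \<delta>) * (norm v)\<^sup>2"
    and lower: "inverse (1 + \<delta>) * (norm v)\<^sup>2 \<le> (norm (F x v))\<^sup>2" for x v
    using assms unfolding distorted_diffeo_def loewner_le_iff_norm by (auto simp flip: Jv)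
  have FG: "F (inv \<Phi> y) (G y v) = v" for y v
  proof -
    have "(\<Phi> \<circ> inv \<Phi> has_derivative F (inv \<Phi> y) \<circ> G y) (at y)"
      by (rule diff_chain_at[OF G F])
    moreover have "\<Phi> \<circ> inv \<Phi> = (\<lambda>x. x)"
      using bij by (auto simp: fun_eq_iff bij_is_surj surj_f_inv_f)
    ultimately have "F (inv \<Phi> y) \<circ> G y = (\<lambda>v. v)"
      by (metis has_derivative_ident has_derivative_unique)
    then show ?thesis by (metis comp_apply)
  qed
  have "inverse (1 + \<delta>) * (norm (G y v))\<^sup>2 \<le> (norm v)\<^sup>2" for y v
    using lower[of "G y v" "inv \<Phi> y"] by (simp add: FG)
  then have upperG: "(norm (G y v))\<^sup>2 \<le> (1 + \<delta>) * (norm v)\<^sup>2" for y v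
    using \<open>\<delta> > 0\<close> by (simp add: field_simps)
  have bound: "(norm (f x - f y))\<^sup>2 \<le> (1 + \<delta>) * (norm (x - y))\<^sup>2"
    if der: "\<And>x. (f has_derivative H x) (at x)" and H: "\<And>x v. (norm (H x v))\<^sup>2 \<le> (1 + \<delta>) * (norm v)\<^sup>2"
    for f :: "real^'n \<Rightarrow> real^'n" and H x y
  proof -
    have "onorm (H x) \<le> sqrt (1 + \<delta>)" for x
    proof (rule onorm_le)
      fix v
      show "norm (H x v) \<le> sqrt (1 + \<delta>) * norm v"
        using real_sqrt_le_mono[OF H[of x v]] by (simp add: real_sqrt_mult)
    qed
    then have "norm (f x - f y) \<le> sqrt (1 + \<delta>) * norm (x - y)"
      using differentiable_bound[of UNIV f H "sqrt (1 + \<delta>)" x y] der by auto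
    then have "(norm (f x - f y))\<^sup>2 \<le> (sqrt (1 + \<delta>) * norm (x - y))\<^sup>2"
      by (intro power_mono) auto
    then show ?thesis using \<open>\<delta> > 0\<close> by (simp add: power_mult_distrib)
  qed
  show "(norm (\<Phi> x - \<Phi> y))\<^sup>2 \<le> (1 + \<delta>) * (norm (x - y))\<^sup>2"
    by (rule bound[OF F upper])
  show "(norm (x - y))\<^sup>2 \<le> (1 + \<delta>) * (norm (\<Phi> x - \<Phi> y))\<^sup>2"
    using bound[OF G upperG, of "\<Phi> x" "\<Phi> y"] bij by (simp add: bij_is_inj)
qed

section \<open>Slides and slow twists\<close>

text \<open>To be read with v a tangent vector, u its image under an isometry and w its image under
  the actual derivative. The factor 1/4 leaves room for squaring: for \<eta> in the unit interval,
  \<open>(1 + \<eta> / 4)\<^sup>2 \<le> 1 + \<eta>\<close> and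
  \<open>1 \<le> (1 + \<eta>) * (1 - \<eta> / 4)\<^sup>2\<close>.\<close>

lemma norm_perturbation_bounds:
  fixes u v w :: "'a::real_normed_vector"
  assumes "norm u = norm v" "norm (w - u) \<le> \<eta> / 4 * norm v" "0 \<le> \<eta>" "\<eta> \<le> 1"
  shows "(norm v)\<^sup>2 \<le> (1 + \<eta>) * (norm w)\<^sup>2" "(norm w)\<^sup>2 \<le> (1 + \<eta>) * (norm v)\<^sup>2"
proof -
  have up: "norm w \<le> (1 + \<eta> / 4) * norm v"
    using norm_triangle_ineq2[of w u] assms by (simp add: algebra_simps)
  have low: "(1 - \<eta> / 4) * norm v \<le> norm w"
    using norm_triangle_ineq2[of u w] assms by (simp add: algebra_simps norm_minus_commute)
  have "\<eta> * \<eta> \<le> \<eta>"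
    using assms mult_left_le[of \<eta> \<eta>] by simp
  then have "(1 + \<eta> / 4)\<^sup>2 \<le> 1 + \<eta>"
    using assms by (simp add: power2_eq_square algebra_simps)
  then have "(1 + \<eta> / 4)\<^sup>2 * (norm v)\<^sup>2 \<le> (1 + \<eta>) * (norm v)\<^sup>2"
    by (rule mult_right_mono) simp
  moreover have "(norm w)\<^sup>2 \<le> ((1 + \<eta> / 4) * norm v)\<^sup>2"
    using up by (intro power_mono) auto
  ultimately show "(norm w)\<^sup>2 \<le> (1 + \<eta>) * (norm v)\<^sup>2"
    by (simp add: power_mult_distrib)
  have "(1 + \<eta>) * (1 - \<eta> / 4)\<^sup>2 = 1 + \<eta> / 2 - 7 / 16 * (\<eta> * \<eta>) + \<eta> * \<eta> * \<eta> / 16"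
    by (simp add: power2_eq_square field_simps)
  moreover have "\<eta> * \<eta> * \<eta> \<ge> 0" using assms by simp
  ultimately have "1 \<le> (1 + \<eta>) * (1 - \<eta> / 4)\<^sup>2"
    using \<open>\<eta> * \<eta> \<le> \<eta>\<close> assms(3) by linarith
  then have "1 * (norm v)\<^sup>2 \<le> ((1 + \<eta>) * (1 - \<eta> / 4)\<^sup>2) * (norm v)\<^sup>2"
    by (rule mult_right_mono) simp
  moreover have "((1 - \<eta> / 4) * norm v)\<^sup>2 \<le> (norm w)\<^sup>2"
    using low assms by (intro power_mono) auto
  then have "(1 + \<eta>) * ((1 - \<eta> / 4) * norm v)\<^sup>2 \<le> (1 + \<eta>) * (norm w)\<^sup>2"
    using assms by (intro mult_left_mono) auto
  ultimately show "(norm v)\<^sup>2 \<le> (1 + \<eta>) * (norm w)\<^sup>2"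
    by (simp add: power_mult_distrib mult_ac)
qed

text \<open>Solving \<open>x + h x = y\<close> is a fixed point problem for the contraction that
  sends x to \<open>y - h x\<close>.\<close>

lemma bij_id_plus_contraction:
  fixes h :: "'a::banach \<Rightarrow> 'a"
  assumes "0 \<le> c" "c < 1" "\<And>x y. norm (h x - h y) \<le> c * norm (x - y)"
  shows "bij (\<lambda>x. x + h x)"
proof -
  have "\<exists>!x. x + h x = y" for y
  proof -
    have "\<exists>!x. y - h x = x"
      using assms by (intro banach_fix_type[of c]) (auto simp: dist_norm norm_minus_commute)
    moreover have "y - h x = x \<longleftrightarrow> x + h x = y" for x
      by (auto simp: algebra_simps)
    ultimately show ?thesis by simp
  qed
  then show ?thesis
    by (intro bijI injI surjI[of _ "\<lambda>y. THE x. x + h x = y"]) (metis, rule theI', blast)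
qed

lemma almost_isometric_diffeo_id_plus_small:
  fixes h :: "real^'n \<Rightarrow> real^'n"
  assumes "\<And>x. (h has_derivative H x) (at x)" "\<And>v. continuous_on UNIV (\<lambda>x. H x v)"
    and "\<And>x v. norm (H x v) \<le> \<eta> / 4 * norm v" "0 < \<eta>" "\<eta> \<le> 1"
  shows "almost_isometric_diffeo (1 + \<eta>) (\<lambda>x. x + h x)"
proof -
  have "onorm (H x) \<le> \<eta> / 4" for x
    using assms(3) by (rule onorm_le)
  then have "norm (h x - h y) \<le> \<eta> / 4 * norm (x - y)" for x y
    using differentiable_bound[of UNIV h H "\<eta> / 4" x y] assms(1) by simp
  then have "bij (\<lambda>x. x + h x)"
    using assms by (intro bij_id_plus_contraction[of "\<eta> / 4"]) auto
  moreover have "((\<lambda>x. x + h x) has_derivative (\<lambda>v. v + H x v)) (at x)" for x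
    by (rule has_derivative_add[OF has_derivative_ident assms(1)])
  moreover have "continuous_on UNIV (\<lambda>x. v + H x v)" for v
    by (intro continuous_intros assms(2))
  moreover have "(norm v)\<^sup>2 \<le> (1 + \<eta>) * (norm (v + H x v))\<^sup>2"
    "(norm (v + H x v))\<^sup>2 \<le> (1 + \<eta>) * (norm v)\<^sup>2" for x v
    using norm_perturbation_bounds[of v v "v + H x v" \<eta>] assms by auto
  ultimately show ?thesis
    unfolding almost_isometric_diffeo_def by (intro conjI exI[of _ "\<lambda>x v. v + H x v"] allI) auto
qed

text \<open>A displacement of size at most \<kappa> * \<rho> meets a cutoff with derivative at most
  2 / (b * \<rho>). The scale cancels, so points with very different radii can be treated in one sum
  and only their number matters.\<close>

lemma almost_isometric_diffeo_slides:
  fixes w :: "real^'n \<Rightarrow> real^'n"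
  assumes "finite Y" "\<And>y. y \<in> Y \<Longrightarrow> \<rho> y > 0" "b > 0"
    and small: "\<And>y. y \<in> Y \<Longrightarrow> norm (w y) \<le> \<kappa> * \<rho> y" "card Y * (2 * \<kappa> / b) \<le> \<eta> / 4"
    and \<eta>: "0 < \<eta>" "\<eta> \<le> 1"
  shows "almost_isometric_diffeo (1 + \<eta>) (\<lambda>x. x + (\<Sum>y\<in>Y. log_cutoff (\<rho> y) b (x - y) *\<^sub>R w y))"
proof (rule almost_isometric_diffeo_id_plus_small[OF _ _ _ \<eta>])
  fix x v :: "real^'n"
  have "((\<lambda>x. log_cutoff (\<rho> y) b (x - y)) has_derivative (\<lambda>v. log_cutoff' (\<rho> y) b (x - y) v)) (at x)"
    if "y \<in> Y" for y
  proof -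
    have "((\<lambda>x. x - y) has_derivative (\<lambda>v. v)) (at x)"
      by (auto intro!: derivative_eq_intros)
    from has_derivative_compose[OF this has_derivative_log_cutoff] show ?thesis
      using assms that by simp
  qed
  then show "((\<lambda>x. \<Sum>y\<in>Y. log_cutoff (\<rho> y) b (x - y) *\<^sub>R w y) has_derivative
      (\<lambda>v. \<Sum>y\<in>Y. log_cutoff' (\<rho> y) b (x - y) v *\<^sub>R w y)) (at x)"
    by (intro has_derivative_sum has_derivative_scaleR_left)
  have "continuous_on UNIV (\<lambda>x. log_cutoff' (\<rho> y) b (x - y) v)" if "y \<in> Y" for y
  proof (rule continuous_on_compose2[OF continuous_on_log_cutoff'])
    show "continuous_on UNIV (\<lambda>x. x - y)" by (intro continuous_intros)
  qed (use assms that in auto)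
  then show "continuous_on UNIV (\<lambda>x. \<Sum>y\<in>Y. log_cutoff' (\<rho> y) b (x - y) v *\<^sub>R w y)"
    by (intro continuous_intros)
  have "norm (log_cutoff' (\<rho> y) b (x - y) v *\<^sub>R w y) \<le> 2 * \<kappa> / b * norm v" if "y \<in> Y" for y
  proof -
    have "norm (log_cutoff' (\<rho> y) b (x - y) v *\<^sub>R w y) \<le> (2 / (b * \<rho> y) * norm v) * (\<kappa> * \<rho> y)"
      unfolding norm_scaleR real_norm_def
      using assms(3) assms(2,4)[OF that] by (intro mult_mono abs_log_cutoff'_le) auto
    also have "\<dots> = 2 * \<kappa> / b * norm v"
      using assms(2)[OF that] by simp
    finally show ?thesis .
  qed
  then have "norm (\<Sum>y\<in>Y. log_cutoff' (\<rho> y) b (x - y) v *\<^sub>R w y) \<le> card Y * (2 * \<kappa> / b * norm v)"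
    by (intro sum_norm_bound)
  also have "\<dots> \<le> \<eta> / 4 * norm v"
    using mult_right_mono[OF small(2) norm_ge_zero[of v]] by (simp add: mult_ac)
  finally show "norm (\<Sum>y\<in>Y. log_cutoff' (\<rho> y) b (x - y) v *\<^sub>R w y) \<le> \<eta> / 4 * norm v" .
qed

text \<open>For orthonormal u and v, the rotation by the angle t in their plane that fixes the
  orthogonal complement. The explicit formula can be differentiated when t varies with the
  point.\<close>

definition plane_rotation :: "'a::real_inner \<Rightarrow> 'a \<Rightarrow> real \<Rightarrow> 'a \<Rightarrow> 'a" where
  "plane_rotation u v t x = x + (cos t - 1) *\<^sub>R ((x \<bullet> u) *\<^sub>R u + (x \<bullet> v) *\<^sub>R v)
                              + sin t *\<^sub>R ((x \<bullet> u) *\<^sub>R v - (x \<bullet> v) *\<^sub>R u)"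

text \<open>The derivative of \<open>plane_rotation\<close> with respect to the angle.\<close>

definition plane_rotation' :: "'a::real_inner \<Rightarrow> 'a \<Rightarrow> real \<Rightarrow> 'a \<Rightarrow> 'a" where
  "plane_rotation' u v t x = (- sin t) *\<^sub>R ((x \<bullet> u) *\<^sub>R u + (x \<bullet> v) *\<^sub>R v)
                              + cos t *\<^sub>R ((x \<bullet> u) *\<^sub>R v - (x \<bullet> v) *\<^sub>R u)"

lemma linear_plane_rotation: "linear (plane_rotation u v t)"
  by (rule linearI) (simp_all add: plane_rotation_def algebra_simps inner_add_left)

lemma plane_rotation_0 [simp]: "plane_rotation u v 0 x = x"
  by (simp add: plane_rotation_def)

lemma plane_rotation_fixes: "x \<bullet> u = 0 \<Longrightarrow> x \<bullet> v = 0 \<Longrightarrow> plane_rotation u v t x = x"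
  by (simp add: plane_rotation_def)

lemma plane_rotation_alt:
  "plane_rotation u v t x = x + ((cos t - 1) * (x \<bullet> u) - sin t * (x \<bullet> v)) *\<^sub>R u
                              + ((cos t - 1) * (x \<bullet> v) + sin t * (x \<bullet> u)) *\<^sub>R v"
  by (simp add: plane_rotation_def algebra_simps)

lemma plane_rotation_inner:
  assumes orthonormal: "u \<bullet> u = 1" "v \<bullet> v = 1" "u \<bullet> v = 0"
  shows "plane_rotation u v t x \<bullet> u = cos t * (x \<bullet> u) - sin t * (x \<bullet> v)"
    and "plane_rotation u v t x \<bullet> v = cos t * (x \<bullet> v) + sin t * (x \<bullet> u)"
proof -
  have "v \<bullet> u = 0" using orthonormal by (simp add: inner_commute)
  then show "plane_rotation u v t x \<bullet> u = cos t * (x \<bullet> u) - sin t * (x \<bullet> v)"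
    and "plane_rotation u v t x \<bullet> v = cos t * (x \<bullet> v) + sin t * (x \<bullet> u)"
    using orthonormal by (simp_all add: plane_rotation_alt inner_add_left algebra_simps)
qed

text \<open>The group law gives the inverse of a twist, the splitting off of a rotation, and the
  half-angle argument for the determinant.\<close>

lemma plane_rotation_add:
  assumes orthonormal: "u \<bullet> u = 1" "v \<bullet> v = 1" "u \<bullet> v = 0"
  shows "plane_rotation u v s (plane_rotation u v t x) = plane_rotation u v (s + t) x"
proof -
  let ?p = "x \<bullet> u" and ?q = "x \<bullet> v"
  define y where "y = plane_rotation u v t x"
  define a b where "a = (cos t - 1) * ?p - sin t * ?q" and "b = (cos t - 1) * ?q + sin t * ?p"
  define a' b' where "a' = (cos s - 1) * (y \<bullet> u) - sin s * (y \<bullet> v)"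
    and "b' = (cos s - 1) * (y \<bullet> v) + sin s * (y \<bullet> u)"
  have "plane_rotation u v s y = y + a' *\<^sub>R u + b' *\<^sub>R v"
    unfolding a'_def b'_def by (rule plane_rotation_alt)
  moreover have "y = x + a *\<^sub>R u + b *\<^sub>R v"
    unfolding y_def a_def b_def by (rule plane_rotation_alt)
  ultimately have "plane_rotation u v s y = x + (a + a') *\<^sub>R u + (b + b') *\<^sub>R v"
    by (simp add: scaleR_add_left)
  moreover have "a + a' = (cos (s + t) - 1) * ?p - sin (s + t) * ?q"
    unfolding a_def a'_def y_def plane_rotation_inner[OF orthonormal] cos_add sin_add
    by (simp add: algebra_simps)
  moreover have "b + b' = (cos (s + t) - 1) * ?q + sin (s + t) * ?p"
    unfolding b_def b'_def y_def plane_rotation_inner[OF orthonormal] cos_add sin_add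
    by (simp add: algebra_simps)
  ultimately show ?thesis
    unfolding plane_rotation_alt[of u v "s + t"] y_def by (simp only:)
qed

lemma orthogonal_plane_rotation:
  assumes orthonormal: "u \<bullet> u = 1" "v \<bullet> v = 1" "u \<bullet> v = 0"
  shows "orthogonal_transformation (plane_rotation u v t)"
proof -
  have "plane_rotation u v t x \<bullet> plane_rotation u v t x = x \<bullet> x" for x
  proof -
    let ?p = "x \<bullet> u" and ?q = "x \<bullet> v"
    define y where "y = plane_rotation u v t x"
    have exp: "z \<bullet> y = z \<bullet> x + ((cos t - 1) * ?p - sin t * ?q) * (z \<bullet> u)
        + ((cos t - 1) * ?q + sin t * ?p) * (z \<bullet> v)" for z
      unfolding y_def plane_rotation_alt by (simp only: inner_add_right inner_scaleR_right)
    have "y \<bullet> y = x \<bullet> y + ((cos t - 1) * ?p - sin t * ?q) * (y \<bullet> u)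
        + ((cos t - 1) * ?q + sin t * ?p) * (y \<bullet> v)"
      using exp[of y] by (simp only: inner_commute[of y x])
    also have "\<dots> = x \<bullet> x + (?p\<^sup>2 + ?q\<^sup>2) * ((sin t)\<^sup>2 + (cos t)\<^sup>2 - 1)"
      unfolding exp[of x] unfolding y_def plane_rotation_inner[OF orthonormal]
      by (simp add: power2_eq_square algebra_simps del: sin_cos_squared_add3)
    finally show ?thesis by (simp add: y_def)
  qed
  then show ?thesis
    unfolding orthogonal_transformation using linear_plane_rotation by (simp add: norm_eq_sqrt_inner)
qed

lemma norm_plane_rotation'_le:
  assumes orthonormal: "u \<bullet> u = 1" "v \<bullet> v = 1" "u \<bullet> v = 0"
  shows "norm (plane_rotation' u v t x) \<le> 4 * norm x"
proof -
  have n: "norm u = 1" "norm v = 1"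
    using orthonormal by (simp_all add: norm_eq_sqrt_inner)
  have p: "\<bar>x \<bullet> u\<bar> \<le> norm x" "\<bar>x \<bullet> v\<bar> \<le> norm x"
    using Cauchy_Schwarz_ineq2[of x u] Cauchy_Schwarz_ineq2[of x v] n by auto
  have "norm ((x \<bullet> u) *\<^sub>R u + (x \<bullet> v) *\<^sub>R v) \<le> 2 * norm x"
    "norm ((x \<bullet> u) *\<^sub>R v - (x \<bullet> v) *\<^sub>R u) \<le> 2 * norm x"
    using norm_triangle_ineq[of "(x \<bullet> u) *\<^sub>R u" "(x \<bullet> v) *\<^sub>R v"]
      norm_triangle_ineq4[of "(x \<bullet> u) *\<^sub>R v" "(x \<bullet> v) *\<^sub>R u"] p n by auto
  then have "\<bar>- sin t\<bar> * norm ((x \<bullet> u) *\<^sub>R u + (x \<bullet> v) *\<^sub>R v) \<le> 1 * (2 * norm x)"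
    "\<bar>cos t\<bar> * norm ((x \<bullet> u) *\<^sub>R v - (x \<bullet> v) *\<^sub>R u) \<le> 1 * (2 * norm x)"
    using abs_sin_le_one[of t] abs_cos_le_one[of t]
    by (intro mult_mono; simp)+
  then show ?thesis
    unfolding plane_rotation'_def by (intro norm_triangle_le) (simp only: norm_scaleR)
qed

text \<open>The transition takes place over a range of scales exponential in \<open>1 / \<eta>\<close>; this is where the
  bound \<open>exp (- C' / \<epsilon>)\<close> of the theorem comes from.\<close>

definition radial_twist :: "nat \<Rightarrow> (real^'n \<Rightarrow> real^'n) \<Rightarrow> bool" where
  "radial_twist N A \<longleftrightarrow> (\<forall>\<eta> b \<rho>. 0 < \<eta> \<longrightarrow> \<eta> \<le> 1 \<longrightarrow> 512 / \<eta> \<le> b \<longrightarrow> 0 < \<rho> \<longrightarrow>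
     (\<exists>T. almost_isometric_diffeo ((1 + \<eta>) ^ N) T \<and> (\<forall>x. norm (T x) = norm x) \<and>
       (\<forall>x. norm x \<le> \<rho> \<longrightarrow> T x = A x) \<and> (\<forall>x. 2 * exp b * \<rho>\<^sup>2 \<le> (norm x)\<^sup>2 \<longrightarrow> T x = x)))"

text \<open>Because twists preserve the norm, both factors see the same inner ball and the same
  outer region, so the range of scales does not grow with the number of factors.\<close>

lemma radial_twist_compose:
  assumes "radial_twist M A" "radial_twist N B" "\<And>x. norm (B x) = norm x"
  shows "radial_twist (M + N) (A \<circ> B)"
  unfolding radial_twist_def
proof (intro allI impI)
  fix \<eta> b \<rho> :: real assume *: "0 < \<eta>" "\<eta> \<le> 1" "512 / \<eta> \<le> b" "0 < \<rho>"
  obtain S where S: "almost_isometric_diffeo ((1 + \<eta>) ^ M) S" "\<And>x. norm (S x) = norm x"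
    "\<And>x. norm x \<le> \<rho> \<Longrightarrow> S x = A x" "\<And>x. 2 * exp b * \<rho>\<^sup>2 \<le> (norm x)\<^sup>2 \<Longrightarrow> S x = x"
    using assms(1) * unfolding radial_twist_def by metis
  obtain T where T: "almost_isometric_diffeo ((1 + \<eta>) ^ N) T" "\<And>x. norm (T x) = norm x"
    "\<And>x. norm x \<le> \<rho> \<Longrightarrow> T x = B x" "\<And>x. 2 * exp b * \<rho>\<^sup>2 \<le> (norm x)\<^sup>2 \<Longrightarrow> T x = x"
    using assms(2) * unfolding radial_twist_def by metis
  have "almost_isometric_diffeo ((1 + \<eta>) ^ (M + N)) (S \<circ> T)"
    unfolding power_add using S(1) T(1) * by (intro almost_isometric_diffeo_compose) auto
  then show "\<exists>T. almost_isometric_diffeo ((1 + \<eta>) ^ (M + N)) T \<and> (\<forall>x. norm (T x) = norm x) \<and>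
       (\<forall>x. norm x \<le> \<rho> \<longrightarrow> T x = (A \<circ> B) x) \<and> (\<forall>x. 2 * exp b * \<rho>\<^sup>2 \<le> (norm x)\<^sup>2 \<longrightarrow> T x = x)"
    using S T assms(3) by (intro exI[of _ "S \<circ> T"]) auto
qed

lemma radial_twist_id: "radial_twist 0 (\<lambda>x. x)"
  unfolding radial_twist_def
  using almost_isometric_diffeo_isometry[OF orthogonal_transformation_id, of 0 0]
  by (intro allI impI exI[of _ "\<lambda>x. x"]) (auto simp: id_def)

lemma radial_twist_mono:
  assumes "radial_twist M A" "M \<le> N"
  shows "radial_twist N A"
proof -
  have "(1 + \<eta>) ^ M \<le> (1 + \<eta>) ^ N" if "0 < \<eta>" for \<eta> :: real
    using assms(2) that by (intro power_increasing) auto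
  then show ?thesis
    using assms(1) almost_isometric_diffeo_mono unfolding radial_twist_def by meson
qed

text \<open>The angle is \<theta> times a radial cutoff, hence constant along the orbits of the
  rotations, and turning back by the same angle inverts the map. The bound 8 admits every angle up
  to 2 * pi.\<close>

lemma radial_twist_plane_rotation:
  fixes u v :: "real^'n"
  assumes uv: "u \<bullet> u = 1" "v \<bullet> v = 1" "u \<bullet> v = 0" and \<theta>: "\<bar>\<theta>\<bar> \<le> 8"
  shows "radial_twist 1 (plane_rotation u v \<theta>)"
  unfolding radial_twist_def
proof (intro allI impI)
  fix \<eta> b \<rho> :: real assume *: "0 < \<eta>" "\<eta> \<le> 1" "512 / \<eta> \<le> b" "0 < \<rho>"
  have "0 < 512 / \<eta>" using * by simp
  then have "b > 0" using * by linarith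
  let ?R = "plane_rotation u v"
  define c where "c = (log_cutoff \<rho> b :: real^'n \<Rightarrow> real)"
  define T where "T = (\<lambda>x. ?R (\<theta> * c x) x)"
  have orth: "orthogonal_transformation (?R t)" for t
    by (rule orthogonal_plane_rotation[OF uv])
  have norm_R: "norm (?R t x) = norm x" for t x
    using orthogonal_transformation_norm[OF orth] .
  have c_R: "c (?R t x) = c x" for t x
    unfolding c_def log_cutoff_def by (simp add: dot_square_norm norm_R)
  have "bij T"
  proof (rule o_bij)
    show "(\<lambda>x. ?R (- (\<theta> * c x)) x) \<circ> T = id" "T \<circ> (\<lambda>x. ?R (- (\<theta> * c x)) x) = id"
      by (auto simp: fun_eq_iff T_def c_R plane_rotation_add[OF uv])
  qed
  define F where "F = (\<lambda>x h. ?R (\<theta> * c x) h +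
      (\<theta> * log_cutoff' \<rho> b x h) *\<^sub>R plane_rotation' u v (\<theta> * c x) x)"
  have dc: "(c has_derivative log_cutoff' \<rho> b x) (at x)" for x
    unfolding c_def using * \<open>b > 0\<close> by (intro has_derivative_log_cutoff)
  have cc: "continuous_on UNIV c"
    using dc has_derivative_continuous by (blast intro: continuous_at_imp_continuous_on)
  have dcos: "((\<lambda>x. cos (\<theta> * c x)) has_derivative (\<lambda>h. - sin (\<theta> * c x) * (\<theta> * log_cutoff' \<rho> b x h))) (at x)"
    and dsin: "((\<lambda>x. sin (\<theta> * c x)) has_derivative (\<lambda>h. cos (\<theta> * c x) * (\<theta> * log_cutoff' \<rho> b x h))) (at x)" for x
    using has_derivative_cos[OF has_derivative_mult_right[OF dc]]
      has_derivative_sin[OF has_derivative_mult_right[OF dc]] by (simp_all add: mult_ac)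
  have "(T has_derivative F x) (at x)" for x
    unfolding T_def F_def plane_rotation_def plane_rotation'_def
    by (rule derivative_eq_intros dcos dsin refl)+ (simp add: fun_eq_iff algebra_simps)
  moreover have "continuous_on UNIV (\<lambda>x. F x h)" for h
    unfolding F_def plane_rotation_def plane_rotation'_def
    using * \<open>b > 0\<close> by (intro continuous_intros cc continuous_on_log_cutoff')
  moreover have "(norm h)\<^sup>2 \<le> (1 + \<eta>) * (norm (F x h))\<^sup>2" "(norm (F x h))\<^sup>2 \<le> (1 + \<eta>) * (norm h)\<^sup>2" for x h
  proof -
    have "norm (F x h - ?R (\<theta> * c x) h) =
        \<bar>\<theta>\<bar> * \<bar>log_cutoff' \<rho> b x h\<bar> * norm (plane_rotation' u v (\<theta> * c x) x)"
      by (simp add: F_def abs_mult)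
    also have "\<dots> \<le> 8 * \<bar>log_cutoff' \<rho> b x h\<bar> * (4 * norm x)"
      using \<theta> norm_plane_rotation'_le[OF uv] by (intro mult_mono) auto
    also have "\<dots> = 32 * (\<bar>log_cutoff' \<rho> b x h\<bar> * norm x)" by simp
    also have "\<dots> \<le> 32 * (4 / b * norm h)"
      using * \<open>b > 0\<close> by (intro mult_left_mono abs_log_cutoff'_le) auto
    also have "\<dots> = 128 / b * norm h" by simp
    \<comment> \<open>This is where 512 comes from: 128 = 8 * 4 * 4 collects the bounds on the
      angle, on the rotation derivative and on the cutoff, and
      \<open>norm_perturbation_bounds\<close> asks for another factor 4.\<close>
    also have "\<dots> \<le> \<eta> / 4 * norm h"
      using * \<open>b > 0\<close> by (intro mult_right_mono) (auto simp: field_simps)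
    finally have "norm (F x h - ?R (\<theta> * c x) h) \<le> \<eta> / 4 * norm h" .
    then show "(norm h)\<^sup>2 \<le> (1 + \<eta>) * (norm (F x h))\<^sup>2" "(norm (F x h))\<^sup>2 \<le> (1 + \<eta>) * (norm h)\<^sup>2"
      using norm_perturbation_bounds[of "?R (\<theta> * c x) h" h "F x h" \<eta>] norm_R * by auto
  qed
  ultimately have "almost_isometric_diffeo (1 + \<eta>) T"
    unfolding almost_isometric_diffeo_def using \<open>bij T\<close> by blast
  moreover have "T x = ?R \<theta> x" if "norm x \<le> \<rho>" for x
    using log_cutoff_eq_1[of \<rho> b x] * \<open>b > 0\<close> that by (simp add: T_def c_def)
  moreover have "T x = x" if "2 * exp b * \<rho>\<^sup>2 \<le> (norm x)\<^sup>2" for x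
    using log_cutoff_eq_0[of \<rho> b x] * \<open>b > 0\<close> that by (simp add: T_def c_def)
  moreover have "norm (T x) = norm x" for x
    by (simp add: T_def norm_R)
  ultimately show "\<exists>T. almost_isometric_diffeo ((1 + \<eta>) ^ 1) T \<and> (\<forall>x. norm (T x) = norm x) \<and>
       (\<forall>x. norm x \<le> \<rho> \<longrightarrow> T x = ?R \<theta> x) \<and> (\<forall>x. 2 * exp b * \<rho>\<^sup>2 \<le> (norm x)\<^sup>2 \<longrightarrow> T x = x)"
    by (intro exI[of _ T]) simp
qed

section \<open>Twisting arbitrary rotations\<close>

lemma linear_eq_id_on_axes:
  fixes A :: "real^'n \<Rightarrow> real^'n"
  assumes "linear A" "\<And>i. A (axis i 1) = axis i 1"
  shows "A = (\<lambda>x. x)"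
proof (rule linear_eq_stdbasis[OF assms(1) linear_ident])
  fix b :: "real^'n" assume "b \<in> Basis"
  then obtain i where "b = axis i 1" by (auto simp: Basis_vec_def)
  then show "A b = b" using assms(2) by simp
qed

text \<open>Orthogonality to the fixed axes forces the image of axis j to be a multiple of axis j.
  The matrix is then diagonal with a single unknown entry, which equals the determinant.\<close>

lemma rotation_fixing_all_but_one_axis:
  fixes A :: "real^'n \<Rightarrow> real^'n"
  assumes A: "orthogonal_transformation A" "det (matrix A) = 1"
    and fixes_axis: "\<And>i. i \<noteq> j \<Longrightarrow> A (axis i 1) = axis i 1"
  shows "A = (\<lambda>x. x)"
proof (rule linear_eq_id_on_axes)
  have orth: "A x \<bullet> A y = x \<bullet> y" for x y
    using A(1) by (simp add: orthogonal_transformation_def)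
  have zero: "A (axis j 1) $ i = 0" if "i \<noteq> j" for i
    using orth[of "axis i 1" "axis j 1"] that by (simp add: fixes_axis inner_axis inner_axis') (simp add: axis_def)
  have entry: "matrix A $ i $ k = A (axis k 1) $ i" for i k
    by (simp add: matrix_def)
  have "det (matrix A) = (\<Prod>i\<in>UNIV. matrix A $ i $ i)"
  proof (rule det_diagonal)
    fix i k :: 'n assume "i \<noteq> k"
    then show "matrix A $ i $ k = 0"
      using zero[of i] fixes_axis[of k] by (cases "k = j") (auto simp: entry axis_def)
  qed
  also have "\<dots> = (\<Prod>i\<in>UNIV. if i = j then A (axis j 1) $ j else 1)"
    using fixes_axis by (intro prod.cong) (auto simp: entry axis_def)
  finally have "A (axis j 1) $ j = 1"
    using A(2) by simp
  then have "A (axis j 1) = axis j 1"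
    using zero by (auto simp: vec_eq_iff axis_def)
  then show "A (axis i 1) = axis i 1" for i
    using fixes_axis by (cases "i = j") auto
qed (use A in \<open>simp add: orthogonal_transformation_linear\<close>)

text \<open>Gram-Schmidt for a against b. The vector w provides a rotation plane in the degenerate
  case that a is a multiple of b, notably for \<open>a = - b\<close>.\<close>

lemma exists_unit_vector_in_plane:
  fixes a b :: "'a::real_inner"
  assumes "subspace W" "a \<in> W" "b \<in> W" "a \<bullet> a = 1" "b \<bullet> b = 1" "w \<in> W" "w \<bullet> w = 1" "b \<bullet> w = 0"
  obtains v \<theta> where "v \<in> W" "v \<bullet> v = 1" "b \<bullet> v = 0" "0 \<le> \<theta>" "\<theta> \<le> 2 * pi" "a = cos \<theta> *\<^sub>R b + sin \<theta> *\<^sub>R v"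
proof -
  define c where "c = a \<bullet> b"
  define r where "r = a - c *\<^sub>R b"
  have rb: "b \<bullet> r = 0"
    using assms by (simp add: r_def c_def inner_diff_right inner_commute)
  obtain v where v: "v \<in> W" "v \<bullet> v = 1" "b \<bullet> v = 0" "r = norm r *\<^sub>R v"
  proof (cases "r = 0")
    case True
    then show ?thesis using that[of w] assms by simp
  next
    case False
    have "r \<in> W" using assms unfolding r_def by (intro subspace_diff subspace_scale)
    then show ?thesis
      using False assms(1) rb
      by (intro that[of "(1 / norm r) *\<^sub>R r"]) (auto simp: subspace_scale dot_square_norm power2_eq_square)
  qed
  have a: "a = c *\<^sub>R b + norm r *\<^sub>R v"
    unfolding v(4)[symmetric] by (simp add: r_def)
  have "a \<bullet> a = c * (b \<bullet> (c *\<^sub>R b + norm r *\<^sub>R v)) + norm r * (v \<bullet> (c *\<^sub>R b + norm r *\<^sub>R v))"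
    by (subst (1 2) a) (simp only: inner_add_left inner_scaleR_left)
  also have "\<dots> = c\<^sup>2 + (norm r)\<^sup>2"
    using v(2,3) assms(5) by (simp add: inner_add_right inner_commute[of v b] power2_eq_square)
  finally have "c\<^sup>2 + (norm r)\<^sup>2 = 1" using assms by simp
  then obtain \<theta> where "0 \<le> \<theta>" "\<theta> < 2 * pi" "c = cos \<theta>" "norm r = sin \<theta>"
    using sincos_total_2pi by metis
  with a v show ?thesis by (intro that[of v \<theta>]) auto
qed

lemma det_orthogonal_compose:
  fixes A B :: "real^'n \<Rightarrow> real^'n"
  assumes "orthogonal_transformation A" "orthogonal_transformation B"
  shows "det (matrix (A \<circ> B)) = det (matrix A) * det (matrix B)"
  using assms by (simp add: matrix_compose orthogonal_transformation_linear det_mul)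

text \<open>A rotation is the square of the rotation by half the angle, so its determinant is the
  square of 1 or -1.\<close>

lemma det_plane_rotation:
  fixes u v :: "real^'n"
  assumes "u \<bullet> u = 1" "v \<bullet> v = 1" "u \<bullet> v = 0"
  shows "det (matrix (plane_rotation u v t)) = 1"
proof -
  have "plane_rotation u v t = plane_rotation u v (t/2) \<circ> plane_rotation u v (t/2)"
    by (simp add: fun_eq_iff plane_rotation_add[OF assms])
  then have "det (matrix (plane_rotation u v t)) = (det (matrix (plane_rotation u v (t/2))))\<^sup>2"
    by (simp add: det_orthogonal_compose orthogonal_plane_rotation[OF assms] power2_eq_square)
  then show ?thesis
    using orthogonal_transformation_det[OF orthogonal_plane_rotation[OF assms], of "t/2"]
    by (metis one_power2 power2_abs)
qed

text \<open>Plane rotations make \<open>A\<close> fix one more basis vector at a time. The determinant is needed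
  only at the end, when a single axis is left.\<close>

lemma radial_twist_rotation_fixing:
  fixes A :: "real^'n \<Rightarrow> real^'n"
  assumes "orthogonal_transformation A" "det (matrix A) = 1" "\<And>i. i \<in> I \<Longrightarrow> A (axis i 1) = axis i 1"
  shows "radial_twist (card (- I)) A"
  using assms
proof (induction "card (- I)" arbitrary: A I rule: less_induct)
  case less
  note A = less.prems(1,2) and fixes_axis = less.prems(3)
  show ?case
  proof (cases "\<exists>j. - I \<subseteq> {j}")
    case True
    then obtain j where "- I \<subseteq> {j}" by blast
    then have "A = (\<lambda>x. x)"
      using fixes_axis by (intro rotation_fixing_all_but_one_axis[OF A, of j]) blast
    then show ?thesis
      using radial_twist_mono[OF radial_twist_id] by simp
  next
    case False
    then obtain j l where jl: "j \<notin> I" "l \<notin> I" "l \<noteq> j" by blast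
    \<comment> \<open>The orthogonal complement of the axes already fixed. A rotation in a plane
      inside W leaves those axes alone; the second free axis l serves as the auxiliary unit
      vector.\<close>
    define W where "W = {x :: real^'n. \<forall>i\<in>I. x $ i = 0}"
    have orth: "A x \<bullet> A y = x \<bullet> y" for x y
      using A(1) by (simp add: orthogonal_transformation_def)
    have "subspace W" by (auto simp: W_def subspace_def)
    moreover have "A (axis j 1) \<in> W"
    proof -
      have "A (axis j 1) $ i = 0" if "i \<in> I" for i
      proof -
        have "A (axis j 1) $ i = A (axis j 1) \<bullet> A (axis i 1)"
          using fixes_axis[OF that] by (simp add: inner_axis)
        also have "\<dots> = 0" using that jl by (simp add: orth inner_axis) (auto simp: axis_def)
        finally show ?thesis .
      qed
      then show ?thesis by (simp add: W_def)
    qed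
    moreover have "axis j 1 \<in> W" "axis l 1 \<in> W" using jl by (auto simp: W_def axis_def)
    moreover have "axis j 1 \<bullet> axis j (1::real) = 1" "axis l 1 \<bullet> axis l (1::real) = 1"
      "axis j 1 \<bullet> axis l (1::real) = 0"
      using jl by (simp_all add: inner_axis) (simp_all add: axis_def)
    ultimately obtain v \<theta> where v: "v \<in> W" "v \<bullet> v = 1" "axis j 1 \<bullet> v = 0"
      and \<theta>: "0 \<le> \<theta>" "\<theta> \<le> 2 * pi" "A (axis j 1) = cos \<theta> *\<^sub>R axis j 1 + sin \<theta> *\<^sub>R v"
      using exists_unit_vector_in_plane[of W "A (axis j 1)" "axis j 1" "axis l 1"]
      unfolding orth by metis
    have on: "axis j (1::real) \<bullet> axis j 1 = 1" "v \<bullet> v = 1" "axis j 1 \<bullet> v = 0"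
      using v by (simp_all add: inner_axis)
    let ?R = "plane_rotation (axis j 1) v"
    have R\<theta>: "?R \<theta> (axis j 1) = A (axis j 1)"
      unfolding \<theta>(3) plane_rotation_alt using on by (simp add: algebra_simps)
    \<comment> \<open>Undoing the rotation that carries axis j to its image leaves a map that fixes
      axis j as well.\<close>
    define B where "B = ?R (- \<theta>) \<circ> A"
    have A_eq: "A = ?R \<theta> \<circ> B"
      by (simp add: B_def fun_eq_iff plane_rotation_add[OF on])
    have R: "orthogonal_transformation (?R t)" for t
      by (rule orthogonal_plane_rotation[OF on])
    have B: "orthogonal_transformation B" "det (matrix B) = 1"
      unfolding B_def using A R
      by (simp_all add: orthogonal_transformation_compose det_orthogonal_compose det_plane_rotation[OF on])
    have "B (axis i 1) = axis i 1" if "i \<in> insert j I" for i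
    proof (cases "i = j")
      case True
      then show ?thesis by (simp add: B_def plane_rotation_add[OF on] flip: R\<theta>)
    next
      case False
      with that have "i \<in> I" by simp
      with v(1) jl have "axis i 1 \<bullet> axis j (1::real) = 0" "axis i 1 \<bullet> v = 0"
        by (simp_all add: W_def inner_axis') (auto simp: axis_def)
      then show ?thesis
        using fixes_axis[OF \<open>i \<in> I\<close>] by (simp add: B_def plane_rotation_fixes)
    qed
    moreover have card: "card (- I) = Suc (card (- insert j I))"
    proof -
      have "- I = insert j (- insert j I)" using jl by auto
      then show ?thesis by (metis Compl_iff card_insert_disjoint finite insertI1)
    qed
    ultimately have "radial_twist (card (- insert j I)) B"
      by (intro less.hyps B) auto
    moreover have "radial_twist 1 (?R \<theta>)"
      using \<theta> pi_less_4 by (intro radial_twist_plane_rotation[OF on]) simp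
    ultimately have "radial_twist (1 + card (- insert j I)) (?R \<theta> \<circ> B)"
      using orthogonal_transformation_norm[OF B(1)] by (intro radial_twist_compose)
    then show ?thesis using A_eq card by simp
  qed
qed

lemma radial_twist_rotation:
  fixes A :: "real^'n \<Rightarrow> real^'n"
  assumes "orthogonal_transformation A" "det (matrix A) = 1"
  shows "radial_twist CARD('n) A"
  using radial_twist_rotation_fixing[OF assms, of "{}"] by simp

section \<open>Rigidity of almost isometric maps\<close>

text \<open>Quantitative Gram-Schmidt, one vector at a time. The smallness of C * \<eta> keeps the
  norm of each residual away from 0, so that it can be normalised.\<close>

lemma near_orthonormal_family:
  assumes "finite I"
  shows "\<exists>C\<ge>1. \<forall>(f :: 'i \<Rightarrow> 'a::real_inner) \<eta>. 0 \<le> \<eta> \<longrightarrow> C * \<eta> \<le> 1 \<longrightarrow>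
    (\<forall>i\<in>I. \<forall>j\<in>I. \<bar>f i \<bullet> f j - (if i = j then 1 else 0)\<bar> \<le> \<eta>) \<longrightarrow>
    (\<exists>a. (\<forall>i\<in>I. \<forall>j\<in>I. a i \<bullet> a j = (if i = j then 1 else 0)) \<and> (\<forall>i\<in>I. norm (a i - f i) \<le> C * \<eta>))"
  using assms
proof (induction I rule: finite_induct)
  case empty
  show ?case by (intro exI[of _ 1]) auto
next
  case (insert k I)
  then obtain C where "C \<ge> 1" and IH: "\<And>(f :: 'i \<Rightarrow> 'a) \<eta>. 0 \<le> \<eta> \<Longrightarrow> C * \<eta> \<le> 1 \<Longrightarrow>
    (\<forall>i\<in>I. \<forall>j\<in>I. \<bar>f i \<bullet> f j - (if i = j then 1 else 0)\<bar> \<le> \<eta>) \<Longrightarrow>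
    (\<exists>a. (\<forall>i\<in>I. \<forall>j\<in>I. a i \<bullet> a j = (if i = j then 1 else 0)) \<and> (\<forall>i\<in>I. norm (a i - f i) \<le> C * \<eta>))"
    by blast
  \<comment> \<open>M * \<eta> bounds the projection of the new vector onto the earlier ones: each
    coefficient costs \<eta>, plus 2 * C * \<eta> for replacing \<open>f j\<close> by
    \<open>a j\<close>. Normalising costs (M + 1) * \<eta> more, whence the factor 2 in C'; the
    summand C preserves the old estimates.\<close>
  define M where "M = card I * (1 + 2 * C)"
  define C' where "C' = 2 * (M + 1) + C"
  have "M \<ge> 0" using \<open>C \<ge> 1\<close> by (simp add: M_def)
  show ?case
  proof (intro exI[of _ C'] conjI allI impI)
    show "C' \<ge> 1" using \<open>M \<ge> 0\<close> \<open>C \<ge> 1\<close> by (simp add: C'_def)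
    fix f :: "'i \<Rightarrow> 'a" and \<eta> :: real
    assume \<eta>: "0 \<le> \<eta>" "C' * \<eta> \<le> 1"
      and f: "\<forall>i\<in>insert k I. \<forall>j\<in>insert k I. \<bar>f i \<bullet> f j - (if i = j then 1 else 0)\<bar> \<le> \<eta>"
    have "0 \<le> C * \<eta>" "0 \<le> M * \<eta>" using \<eta> \<open>M \<ge> 0\<close> \<open>C \<ge> 1\<close> by simp_all
    moreover have "C' * \<eta> = 2 * ((M + 1) * \<eta>) + C * \<eta>" "(M + 1) * \<eta> = M * \<eta> + \<eta>"
      by (simp_all add: C'_def algebra_simps)
    ultimately have small: "(M + 1) * \<eta> \<le> 1 / 2" "C * \<eta> \<le> 1" and CC': "C * \<eta> \<le> C' * \<eta>"
      using \<eta> by linarith+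
    obtain a where a: "\<And>i j. i \<in> I \<Longrightarrow> j \<in> I \<Longrightarrow> a i \<bullet> a j = (if i = j then 1 else 0)"
      and af: "\<And>i. i \<in> I \<Longrightarrow> norm (a i - f i) \<le> C * \<eta>"
      using IH[of \<eta> f] f \<eta> small by auto
    define g where "g = f k - (\<Sum>j\<in>I. (f k \<bullet> a j) *\<^sub>R a j)"
    have "\<bar>(norm (f k))\<^sup>2 - 1\<bar> \<le> \<eta>"
      using f by (simp add: power2_norm_eq_inner)
    moreover have "(norm (f k))\<^sup>2 - 1 = (norm (f k) - 1) * (norm (f k) + 1)"
      by (simp add: power2_eq_square algebra_simps)
    moreover have "\<bar>norm (f k) - 1\<bar> * 1 \<le> \<bar>norm (f k) - 1\<bar> * \<bar>norm (f k) + 1\<bar>"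
      by (intro mult_left_mono) auto
    ultimately have nf: "\<bar>norm (f k) - 1\<bar> \<le> \<eta>"
      by (simp add: abs_mult)
    have "M * \<eta> \<ge> 0" using \<open>M \<ge> 0\<close> \<eta> by simp
    with small have "\<eta> \<le> 1 / 2" by (simp add: algebra_simps)
    have fa: "\<bar>f k \<bullet> a j\<bar> \<le> (1 + 2 * C) * \<eta>" if "j \<in> I" for j
    proof -
      have "f k \<bullet> a j = f k \<bullet> f j + f k \<bullet> (a j - f j)"
        by (simp add: inner_diff_right)
      moreover have "\<bar>f k \<bullet> f j\<bar> \<le> \<eta>"
        using f[rule_format, of k j] that insert.hyps by (auto split: if_splits)
      moreover have "\<bar>f k \<bullet> (a j - f j)\<bar> \<le> norm (f k) * norm (a j - f j)"
        by (rule Cauchy_Schwarz_ineq2)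
      moreover have "norm (f k) * norm (a j - f j) \<le> 2 * (C * \<eta>)"
        using nf \<open>\<eta> \<le> 1 / 2\<close> af[OF that] by (intro mult_mono) auto
      ultimately show ?thesis by (simp add: algebra_simps)
    qed
    have na: "norm (a j) = 1" if "j \<in> I" for j
      using a[OF that that] by (simp add: norm_eq_sqrt_inner)
    have "norm (\<Sum>j\<in>I. (f k \<bullet> a j) *\<^sub>R a j) \<le> card I * ((1 + 2 * C) * \<eta>)"
      using fa na by (intro sum_norm_bound) simp
    then have gf: "norm (g - f k) \<le> M * \<eta>"
      by (simp add: g_def M_def mult_ac)
    then have ng: "\<bar>norm g - 1\<bar> \<le> (M + 1) * \<eta>"
      using nf norm_triangle_ineq3[of g "f k"] by (simp add: algebra_simps)
    then have "norm g \<noteq> 0" using small by auto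
    have ga: "g \<bullet> a i = 0" if "i \<in> I" for i
    proof -
      have "(\<Sum>j\<in>I. (f k \<bullet> a j) * (a j \<bullet> a i)) = (\<Sum>j\<in>I. if j = i then f k \<bullet> a j else 0)"
        using a that by (intro sum.cong) auto
      then show ?thesis
        using that insert.hyps by (simp add: g_def inner_diff_left inner_sum_left)
    qed
    define b where "b = (1 / norm g) *\<^sub>R g"
    have "b \<bullet> b = 1"
      using \<open>norm g \<noteq> 0\<close> by (simp add: b_def dot_square_norm power2_eq_square)
    have "norm (b - g) = \<bar>norm g - 1\<bar>"
    proof -
      have "b - g = (1 / norm g - 1) *\<^sub>R g" by (simp add: b_def algebra_simps)
      then have "norm (b - g) = \<bar>(1 / norm g - 1) * norm g\<bar>" by (simp add: abs_mult)
      also have "(1 / norm g - 1) * norm g = 1 - norm g"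
        using \<open>norm g \<noteq> 0\<close> by (simp add: field_simps)
      finally show ?thesis by simp
    qed
    then have "norm (b - f k) \<le> (M + 1) * \<eta> + M * \<eta>"
      using norm_triangle_le[of "b - g" "g - f k"] ng gf by simp
    also have "\<dots> \<le> C' * \<eta>"
      using \<eta> \<open>C \<ge> 1\<close> by (simp add: C'_def algebra_simps add_increasing)
    finally have bf: "norm (b - f k) \<le> C' * \<eta>" .
    have ba: "b \<bullet> a i = 0" "a i \<bullet> b = 0" if "i \<in> I" for i
      using ga[OF that] by (simp_all add: b_def inner_commute)
    have ne: "i \<noteq> k" if "i \<in> I" for i using that insert.hyps by auto
    show "\<exists>a. (\<forall>i\<in>insert k I. \<forall>j\<in>insert k I. a i \<bullet> a j = (if i = j then 1 else 0)) \<and>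
        (\<forall>i\<in>insert k I. norm (a i - f i) \<le> C' * \<eta>)"
    proof (intro exI[of _ "a(k := b)"] conjI ballI)
      fix i j assume "i \<in> insert k I" "j \<in> insert k I"
      then show "(a(k := b)) i \<bullet> (a(k := b)) j = (if i = j then 1 else 0)"
        using a ba ne \<open>b \<bullet> b = 1\<close> by auto
    next
      fix i assume "i \<in> insert k I"
      then show "norm ((a(k := b)) i - f i) \<le> C' * \<eta>"
        using af[of i] bf ne[of i] CC' by auto
    qed
  qed
qed

lemma orthogonal_transformation_of_orthonormal:
  fixes a :: "'n::finite \<Rightarrow> real^'n"
  assumes "\<And>i j. a i \<bullet> a j = (if i = j then 1 else 0)"
  shows "orthogonal_transformation (\<lambda>x. \<Sum>i\<in>UNIV. x $ i *\<^sub>R a i)"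
  unfolding orthogonal_transformation_def
proof (intro conjI allI)
  show "linear (\<lambda>x. \<Sum>i\<in>UNIV. x $ i *\<^sub>R a i)"
    by (rule linearI) (simp_all add: algebra_simps sum.distrib scaleR_sum_right)
  fix v w :: "real^'n"
  have "(\<Sum>i\<in>UNIV. v $ i *\<^sub>R a i) \<bullet> (\<Sum>i\<in>UNIV. w $ i *\<^sub>R a i) = (\<Sum>i\<in>UNIV. v $ i * w $ i)"
    by (simp add: inner_sum_left inner_sum_right assms if_distrib mult.commute cong: if_cong)
  then show "(\<Sum>i\<in>UNIV. v $ i *\<^sub>R a i) \<bullet> (\<Sum>i\<in>UNIV. w $ i *\<^sub>R a i) = v \<bullet> w"
    by (simp add: inner_vec_def)
qed

text \<open>Only \<open>A\<close> is linear, so the mixed term \<open>W v \<bullet> A v\<close> is what gets expanded.\<close>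

lemma rigidity:
  fixes W A :: "real^'n \<Rightarrow> real^'n"
  assumes A: "orthogonal_transformation A" and "finite I" "card I \<le> N" "0 \<le> \<eta>" "\<eta> \<le> 1"
    and W: "\<bar>W v \<bullet> W v - v \<bullet> v\<bar> \<le> \<eta>" "\<And>i. i \<in> I \<Longrightarrow> \<bar>W v \<bullet> W (f i) - v \<bullet> f i\<bar> \<le> \<eta>"
    and WA: "\<And>i. i \<in> I \<Longrightarrow> norm (W (f i) - A (f i)) \<le> \<eta>"
    and v: "v = (\<Sum>i\<in>I. c i *\<^sub>R f i) + r" "norm v \<le> 1" and c: "\<And>i. i \<in> I \<Longrightarrow> \<bar>c i\<bar> \<le> 1"
    and r: "norm r \<le> \<eta>"
  shows "(norm (W v - A v))\<^sup>2 \<le> (6 * real N + 7) * \<eta>"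
proof -
  have lin: "linear A" using A by (rule orthogonal_transformation_linear)
  have "v \<bullet> v \<le> 1" using v(2) by (simp add: dot_square_norm abs_square_le_1)
  then have "(norm (W v))\<^sup>2 \<le> 2\<^sup>2"
    using W(1) \<open>\<eta> \<le> 1\<close> by (simp add: power2_norm_eq_inner)
  then have W2: "norm (W v) \<le> 2" by (rule power2_le_imp_le) simp
  have summand: "\<bar>c i * (v \<bullet> f i - W v \<bullet> A (f i))\<bar> \<le> 3 * \<eta>" if "i \<in> I" for i
  proof -
    have "v \<bullet> f i - W v \<bullet> A (f i) = - (W v \<bullet> W (f i) - v \<bullet> f i) + W v \<bullet> (W (f i) - A (f i))"
      by (simp add: inner_diff_right)
    moreover have "\<bar>W v \<bullet> (W (f i) - A (f i))\<bar> \<le> norm (W v) * norm (W (f i) - A (f i))"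
      by (rule Cauchy_Schwarz_ineq2)
    moreover have "norm (W v) * norm (W (f i) - A (f i)) \<le> 2 * \<eta>"
      using W2 WA[OF that] by (intro mult_mono) auto
    ultimately have "\<bar>v \<bullet> f i - W v \<bullet> A (f i)\<bar> \<le> 3 * \<eta>"
      using W(2)[OF that] by linarith
    then have "\<bar>c i\<bar> * \<bar>v \<bullet> f i - W v \<bullet> A (f i)\<bar> \<le> 1 * (3 * \<eta>)"
      using c[OF that] by (intro mult_mono) auto
    then show ?thesis by (simp add: abs_mult)
  qed
  have "A v = (\<Sum>i\<in>I. c i *\<^sub>R A (f i)) + A r"
    unfolding v(1) by (simp add: linear_add[OF lin] linear_sum[OF lin] linear_scale[OF lin])
  then have "W v \<bullet> A v = (\<Sum>i\<in>I. c i * (W v \<bullet> A (f i))) + W v \<bullet> A r"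
    by (simp add: inner_add_right inner_sum_right)
  moreover have "v \<bullet> v = (\<Sum>i\<in>I. c i * (v \<bullet> f i)) + v \<bullet> r"
    by (subst (2) v(1)) (simp add: inner_add_right inner_sum_right)
  \<comment> \<open>The two expansions are compared term by term: W almost preserves the inner
    product of v with \<open>f i\<close>, and \<open>W (f i)\<close> is close to
    \<open>A (f i)\<close>, so each term is at most 3 * \<eta>.\<close>
  ultimately have S: "v \<bullet> v - W v \<bullet> A v =
      (\<Sum>i\<in>I. c i * (v \<bullet> f i - W v \<bullet> A (f i))) + (v \<bullet> r - W v \<bullet> A r)"
    by (simp add: sum_subtractf algebra_simps)
  have "\<bar>\<Sum>i\<in>I. c i * (v \<bullet> f i - W v \<bullet> A (f i))\<bar> \<le> card I * (3 * \<eta>)"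
    using sum_norm_bound[of I "\<lambda>i. c i * (v \<bullet> f i - W v \<bullet> A (f i))" "3 * \<eta>"] summand by simp
  also have "\<dots> \<le> N * (3 * \<eta>)"
    using assms by (intro mult_right_mono) auto
  finally have "\<bar>\<Sum>i\<in>I. c i * (v \<bullet> f i - W v \<bullet> A (f i))\<bar> \<le> N * (3 * \<eta>)" .
  moreover have "\<bar>v \<bullet> r\<bar> \<le> norm v * norm r" "\<bar>W v \<bullet> A r\<bar> \<le> norm (W v) * norm (A r)"
    by (rule Cauchy_Schwarz_ineq2)+
  moreover have "norm v * norm r \<le> 1 * \<eta>" "norm (W v) * norm (A r) \<le> 2 * \<eta>"
    using v(2) r W2 by (intro mult_mono; simp add: orthogonal_transformation_norm[OF A])+
  ultimately have "v \<bullet> v - W v \<bullet> A v \<le> N * (3 * \<eta>) + 3 * \<eta>"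
    unfolding S by linarith
  \<comment> \<open>One \<eta> from the first bracket and twice (3 * N + 3) * \<eta> from the second
    give 6 * N + 7. Only the square of the distance is controlled, which costs a square
    root.\<close>
  moreover have "(norm (W v - A v))\<^sup>2 = (W v \<bullet> W v - v \<bullet> v) + 2 * (v \<bullet> v - W v \<bullet> A v)"
    using A unfolding orthogonal_transformation_def
    by (simp add: power2_norm_eq_inner inner_diff_left inner_diff_right inner_commute[of "A v" "W v"])
  ultimately show ?thesis using W(1) by (simp add: algebra_simps)
qed

section \<open>Determinants of matrices near an orthogonal one\<close>

lemma continuous_on_det:
  fixes M :: "'a::topological_space \<Rightarrow> real^'n^'n"
  assumes "\<And>i j. continuous_on S (\<lambda>x. M x $ i $ j)"
  shows "continuous_on S (\<lambda>x. det (M x))"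
  unfolding det_def by (intro continuous_intros assms)

lemma sgn_eq_on_connected:
  fixes g :: "'a::topological_space \<Rightarrow> real"
  assumes "connected S" "continuous_on S g" "\<And>x. x \<in> S \<Longrightarrow> g x \<noteq> 0" "x \<in> S" "y \<in> S"
  shows "sgn (g x) = sgn (g y)"
proof (rule ccontr)
  assume "sgn (g x) \<noteq> sgn (g y)"
  then have "g x < 0 \<and> 0 < g y \<or> g y < 0 \<and> 0 < g x"
    using assms(3)[of x] assms(3)[of y] assms(4,5) by (auto simp: sgn_if split: if_splits)
  moreover have "connected (g ` S)" by (rule connected_continuous_image[OF assms(2,1)])
  ultimately have "0 \<in> g ` S"
    using connectedD_interval[of "g ` S" "g x" "g y" 0] connectedD_interval[of "g ` S" "g y" "g x" 0] assms(4,5)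
    by auto
  then show False using assms(3) by force
qed

text \<open>Every matrix on the segment from A to the matrix with columns F is invertible: the
  perturbation moves \<open>A x\<close> by at most \<open>CARD('n) * \<kappa> * norm x\<close>,
  which is less than \<open>norm (A x)\<close> for nonzero x. Hence the determinant keeps its
  sign.\<close>

lemma sgn_det_near_orthogonal:
  fixes A :: "real^'n \<Rightarrow> real^'n" and F :: "'n \<Rightarrow> real^'n" and \<kappa> :: real
  assumes A: "orthogonal_transformation A"
    and F: "\<And>j. norm (F j - A (axis j 1)) \<le> \<kappa>" "CARD('n) * \<kappa> < 1"
  shows "det (\<chi> i j. F j $ i) \<noteq> 0" "sgn (det (\<chi> i j. F j $ i)) = sgn (det (matrix A))"
proof -
  define N where "N = (\<lambda>t. (\<chi> i j. (A (axis j 1) + t *\<^sub>R (F j - A (axis j 1))) $ i) :: real^'n^'n)"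
  have lin: "linear A" using A by (rule orthogonal_transformation_linear)
  have "\<kappa> \<ge> 0" using F(1) norm_ge_zero order_trans by blast
  have nz: "det (N t) \<noteq> 0" if t: "t \<in> {0..1}" for t
  proof -
    have "x = 0" if "N t *v x = 0" for x
    proof (rule ccontr)
      assume "x \<noteq> 0"
      have Ax: "A x = (\<Sum>j\<in>UNIV. x $ j *\<^sub>R A (axis j 1))"
        by (subst (1) basis_expansion[of x, symmetric])
          (simp add: linear_sum[OF lin] linear_scale[OF lin] scalar_mult_eq_scaleR)
      have "N t *v x = A x + t *\<^sub>R (\<Sum>j\<in>UNIV. x $ j *\<^sub>R (F j - A (axis j 1)))"
        unfolding Ax
        by (simp add: vec_eq_iff matrix_vector_mult_def N_def sum.distrib[symmetric] sum_distrib_left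
            algebra_simps)
      then have eq: "A x = - (t *\<^sub>R (\<Sum>j\<in>UNIV. x $ j *\<^sub>R (F j - A (axis j 1))))"
        using that by (simp add: eq_neg_iff_add_eq_0)
      have "norm (\<Sum>j\<in>UNIV. x $ j *\<^sub>R (F j - A (axis j 1))) \<le> CARD('n) * (norm x * \<kappa>)"
        unfolding norm_scaleR using F(1) component_le_norm_cart[of x] \<open>\<kappa> \<ge> 0\<close>
        by (intro sum_norm_bound) (auto intro!: mult_mono)
      then have "t * norm (\<Sum>j\<in>UNIV. x $ j *\<^sub>R (F j - A (axis j 1))) \<le> 1 * (CARD('n) * (norm x * \<kappa>))"
        using t by (intro mult_mono) auto
      then have "norm x \<le> CARD('n) * \<kappa> * norm x"
        using arg_cong[OF eq, of norm] t by (simp add: orthogonal_transformation_norm[OF A] mult_ac)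
      then show False using \<open>x \<noteq> 0\<close> F(2) by simp
    qed
    then show ?thesis
      by (metis invertible_det_nz invertible_left_inverse matrix_left_invertible_ker)
  qed
  have "continuous_on {0..1} (\<lambda>t. det (N t))"
    unfolding N_def by (intro continuous_on_det) (auto intro!: continuous_intros)
  from sgn_eq_on_connected[OF connected_Icc this nz, of 1 0]
  have "sgn (det (N 1)) = sgn (det (N 0))" by simp
  moreover have "N 1 = (\<chi> i j. F j $ i)" "N 0 = matrix A"
    by (simp_all add: N_def matrix_def)
  ultimately show "det (\<chi> i j. F j $ i) \<noteq> 0" "sgn (det (\<chi> i j. F j $ i)) = sgn (det (matrix A))"
    using nz[of 1] by simp_all
qed

section \<open>Orientation and approximating motions\<close>

text \<open>Adding the short vectors \<open>t * axis i 1\<close> makes \<open>V\<close> spanning; then a choice of vectors maximising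
  the determinant works by Cramer's rule.\<close>

lemma barycentric_spanner:
  fixes V :: "(real^'n) set" and t :: real
  assumes "finite V" "t > 0"
  obtains f :: "'n \<Rightarrow> real^'n" and I where "f ` I \<subseteq> V"
    "\<And>v. v \<in> V \<Longrightarrow> \<exists>c r. v = (\<Sum>i\<in>I. c i *\<^sub>R f i) + r \<and> (\<forall>i. \<bar>c i\<bar> \<le> 1) \<and> norm r \<le> CARD('n) * t"
proof -
  define X where "X = V \<union> range (\<lambda>i::'n. t *\<^sub>R axis i (1::real))"
  define S where "S = {f :: 'n \<Rightarrow> real^'n. \<forall>i. f i \<in> X}"
  define d where "d = (\<lambda>f :: 'n \<Rightarrow> real^'n. \<bar>det (\<chi> i. f i)\<bar>)"
  have "finite X" using assms by (simp add: X_def)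
  then have "finite S"
    using finite_PiE[OF finite[of "UNIV :: 'n set"], of "\<lambda>_. X"] by (simp add: S_def PiE_UNIV_domain Pi_def)
  have base: "(\<lambda>i. t *\<^sub>R axis i 1) \<in> S" unfolding S_def X_def by blast
  obtain f where f: "f \<in> S" and max: "\<And>g. g \<in> S \<Longrightarrow> d g \<le> d f"
  proof -
    have "Max (d ` S) \<in> d ` S" using \<open>finite S\<close> base by (intro Max_in) auto
    then obtain f where "f \<in> S" "d f = Max (d ` S)" by auto
    then show ?thesis using \<open>finite S\<close> by (intro that[of f]) auto
  qed
  let ?A = "\<chi> i. f i"
  have "det (\<chi> i. (t *\<^sub>R axis i 1 :: real^'n)) = (\<Prod>i\<in>(UNIV :: 'n set). t)"
    by (subst det_diagonal) (auto simp: axis_def)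
  then have "d (\<lambda>i. t *\<^sub>R axis i 1) > 0" using assms(2) by (simp add: d_def)
  with max[OF base] have df: "d f > 0" by linarith
  then have nz: "det ?A \<noteq> 0" by (simp add: d_def)
  \<comment> \<open>Only vectors chosen from V are kept; the remaining ones are short auxiliary
    vectors, and with coefficients at most 1 they go into the remainder r.\<close>
  define I where "I = {i. f i \<in> V}"
  show ?thesis
  proof (rule that[of f I])
    show "f ` I \<subseteq> V" by (auto simp: I_def)
    fix v assume "v \<in> V"
    have "invertible (transpose ?A)" using nz by (simp add: invertible_det_nz)
    then obtain B where B: "transpose ?A ** B = mat 1" unfolding invertible_def by blast
    define x where "x = B *v v"
    have "transpose ?A *v x = v"
      by (simp add: x_def matrix_vector_mul_assoc B)
    then have v: "v = (\<Sum>i\<in>UNIV. x $ i *s f i)"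
      unfolding matrix_mult_sum by (simp add: column_def transpose_def)
    have "\<bar>x $ k\<bar> \<le> 1" for k
    proof -
      have "(\<chi> i. if i = k then \<Sum>i\<in>UNIV. x $ i *s row i ?A else row i ?A) = (\<chi> i. (f(k := v)) i)"
        using v by (simp add: vec_eq_iff row_def)
      then have "x $ k * det ?A = det (\<chi> i. (f(k := v)) i)"
        using cramer_lemma_transpose[of k x ?A] by simp
      then have "\<bar>x $ k\<bar> * d f = d (f(k := v))"
        by (simp add: d_def fun_upd_def flip: abs_mult)
      also have "\<dots> \<le> d f"
        using f \<open>v \<in> V\<close> by (intro max) (auto simp: S_def X_def)
      finally show ?thesis using df by simp
    qed
    note x = this
    define r where "r = (\<Sum>i\<in>- I. x $ i *\<^sub>R f i)"
    have "norm (x $ i *\<^sub>R f i) \<le> t" if "i \<in> - I" for i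
    proof -
      have "f i \<in> range (\<lambda>j. t *\<^sub>R axis j 1)"
        using f that by (auto simp: S_def X_def I_def)
      then obtain j where "f i = t *\<^sub>R axis j 1" by blast
      then have "norm (f i) = t" using assms(2) by simp
      then show ?thesis
        using mult_right_mono[OF x[of i], of t] assms(2) by simp
    qed
    then have "norm r \<le> card (- I) * t"
      unfolding r_def by (rule sum_norm_bound)
    also have "\<dots> \<le> CARD('n) * t"
      using assms(2) by (intro mult_right_mono) (auto intro: card_mono)
    finally have "norm r \<le> CARD('n) * t" .
    moreover have "v = (\<Sum>i\<in>I. x $ i *\<^sub>R f i) + r"
      using v sum.union_disjoint[of I "- I" "\<lambda>i. x $ i *\<^sub>R f i"]
      by (simp add: r_def scalar_mult_eq_scaleR Compl_partition)
    ultimately show "\<exists>c r. v = (\<Sum>i\<in>I. c i *\<^sub>R f i) + r \<and> (\<forall>i. \<bar>c i\<bar> \<le> 1) \<and> norm r \<le> CARD('n) * t"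
      using x by blast
  qed
qed

section \<open>Near-isometries: blow-ups, local motions and orientation\<close>

definition near_isometric_on :: "real \<Rightarrow> ('a::real_normed_vector) set \<Rightarrow> ('a \<Rightarrow> 'b::real_normed_vector) \<Rightarrow> bool" where
  "near_isometric_on \<delta> S f \<longleftrightarrow> (\<forall>x\<in>S. \<forall>y\<in>S.
     (norm (f x - f y))\<^sup>2 \<le> (1 + \<delta>) * (norm (x - y))\<^sup>2 \<and> (norm (x - y))\<^sup>2 \<le> (1 + \<delta>) * (norm (f x - f y))\<^sup>2)"

text \<open>The blow-up of f at x from scale r to scale 1, normalised to fix the origin. It makes
  all estimates independent of the scale.\<close>

definition rescaled :: "('a::real_vector \<Rightarrow> 'a) \<Rightarrow> 'a \<Rightarrow> real \<Rightarrow> 'a \<Rightarrow> 'a" where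
  "rescaled f x r u = (f (x + r *\<^sub>R u) - f x) /\<^sub>R r"

lemma near_isometric_on_diff:
  assumes "near_isometric_on \<delta> S f" "x \<in> S" "y \<in> S" "\<delta> \<ge> 0"
  shows "\<bar>(norm (f x - f y))\<^sup>2 - (norm (x - y))\<^sup>2\<bar> \<le> \<delta> * (norm (x - y))\<^sup>2"
proof -
  let ?a = "(norm (f x - f y))\<^sup>2" and ?b = "(norm (x - y))\<^sup>2"
  have *: "?a \<le> (1 + \<delta>) * ?b" "?b \<le> (1 + \<delta>) * ?a"
    using assms unfolding near_isometric_on_def by auto
  have "?b - ?a \<le> \<delta> * ?b"
  proof (cases "?a \<le> ?b")
    case True
    then have "\<delta> * ?a \<le> \<delta> * ?b" using assms by (intro mult_left_mono)
    then show ?thesis using * by (simp add: algebra_simps)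
  next
    case False
    moreover have "0 \<le> \<delta> * ?b" using assms by simp
    ultimately show ?thesis by linarith
  qed
  then show ?thesis using * by (simp add: abs_le_iff algebra_simps)
qed

text \<open>Polarisation: the squared norms of u, v and u - v are preserved up to \<delta>, \<delta>
  and 4 * \<delta>, and half of the sum is 3 * \<delta>.\<close>

lemma rescaled_inner:
  fixes f :: "'a::real_inner \<Rightarrow> 'a"
  assumes f: "near_isometric_on \<delta> S f" "x \<in> S" "x + r *\<^sub>R u \<in> S" "x + r *\<^sub>R v \<in> S"
    and "\<delta> \<ge> 0" "r > 0" "norm u \<le> 1" "norm v \<le> 1"
  shows "\<bar>rescaled f x r u \<bullet> rescaled f x r v - u \<bullet> v\<bar> \<le> 3 * \<delta>"
proof -
  let ?W = "rescaled f x r"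
  have scale: "\<bar>(norm (a /\<^sub>R r))\<^sup>2 - (norm b)\<^sup>2\<bar> \<le> \<delta> * (norm b)\<^sup>2"
    if "\<bar>(norm a)\<^sup>2 - (norm (r *\<^sub>R b))\<^sup>2\<bar> \<le> \<delta> * (norm (r *\<^sub>R b))\<^sup>2" for a b :: 'a
  proof -
    have "r\<^sup>2 * \<bar>(norm (a /\<^sub>R r))\<^sup>2 - (norm b)\<^sup>2\<bar> = \<bar>r\<^sup>2 * (norm (a /\<^sub>R r))\<^sup>2 - r\<^sup>2 * (norm b)\<^sup>2\<bar>"
      by (simp add: abs_mult flip: right_diff_distrib)
    also have "r\<^sup>2 * (norm (a /\<^sub>R r))\<^sup>2 = (norm a)\<^sup>2"
      using \<open>r > 0\<close> by (simp add: power_mult_distrib power_inverse)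
    finally have "r\<^sup>2 * \<bar>(norm (a /\<^sub>R r))\<^sup>2 - (norm b)\<^sup>2\<bar> \<le> r\<^sup>2 * (\<delta> * (norm b)\<^sup>2)"
      using that by (simp add: power_mult_distrib mult_ac)
    then show ?thesis using \<open>r > 0\<close> by simp
  qed
  have 1: "\<bar>(norm (?W u))\<^sup>2 - (norm u)\<^sup>2\<bar> \<le> \<delta> * (norm u)\<^sup>2"
    using near_isometric_on_diff[OF f(1) f(3) f(2) \<open>\<delta> \<ge> 0\<close>]
    unfolding rescaled_def by (intro scale) simp
  have 2: "\<bar>(norm (?W v))\<^sup>2 - (norm v)\<^sup>2\<bar> \<le> \<delta> * (norm v)\<^sup>2"
    using near_isometric_on_diff[OF f(1) f(4) f(2) \<open>\<delta> \<ge> 0\<close>]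
    unfolding rescaled_def by (intro scale) simp
  have W_diff: "?W u - ?W v = (f (x + r *\<^sub>R u) - f (x + r *\<^sub>R v)) /\<^sub>R r"
    unfolding rescaled_def scaleR_diff_right by simp
  have uv_diff: "(x + r *\<^sub>R u) - (x + r *\<^sub>R v) = r *\<^sub>R (u - v)"
    by (simp add: scaleR_diff_right)
  have 3: "\<bar>(norm (?W u - ?W v))\<^sup>2 - (norm (u - v))\<^sup>2\<bar> \<le> \<delta> * (norm (u - v))\<^sup>2"
    using near_isometric_on_diff[OF f(1) f(3) f(4) \<open>\<delta> \<ge> 0\<close>]
    unfolding W_diff uv_diff by (rule scale)
  have polar: "a \<bullet> b = ((norm a)\<^sup>2 + (norm b)\<^sup>2 - (norm (a - b))\<^sup>2) / 2" for a b :: 'a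
    unfolding power2_norm_eq_inner inner_diff_left inner_diff_right inner_commute[of b a] by simp
  have "(norm u)\<^sup>2 \<le> 1" "(norm v)\<^sup>2 \<le> 1"
    using assms by (simp_all add: power_le_one)
  moreover have "norm (u - v) \<le> 2"
    using norm_triangle_ineq4[of u v] assms by linarith
  then have "(norm (u - v))\<^sup>2 \<le> 2\<^sup>2" by (intro power_mono) auto
  then have "(norm (u - v))\<^sup>2 \<le> 4" by simp
  ultimately have "\<delta> * (norm u)\<^sup>2 \<le> \<delta> * 1" "\<delta> * (norm v)\<^sup>2 \<le> \<delta> * 1" "\<delta> * (norm (u - v))\<^sup>2 \<le> \<delta> * 4"
    using \<open>\<delta> \<ge> 0\<close> by (simp_all only: mult_left_mono)
  note bounds = order_trans[OF 1 this(1)] order_trans[OF 2 this(2)] order_trans[OF 3 this(3)]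
  have "\<bar>(a + b - c) / 2 - (a' + b' - c') / 2\<bar> \<le> 3 * \<delta>"
    if "\<bar>a - a'\<bar> \<le> \<delta> * 1" "\<bar>b - b'\<bar> \<le> \<delta> * 1" "\<bar>c - c'\<bar> \<le> \<delta> * 4" for a b c a' b' c' :: real
    using that by (auto simp: abs_le_iff field_simps)
  from this[OF bounds] show ?thesis
    unfolding polar[of "?W u" "?W v"] polar[of u v] .
qed

text \<open>A derivative-free substitute for the Jacobian determinant that makes sense at every
  finite scale.\<close>

definition frame_det :: "(real^'n \<Rightarrow> real^'n) \<Rightarrow> real^'n \<Rightarrow> real \<Rightarrow> real" where
  "frame_det f x r = det (\<chi> i j. rescaled f x r (axis j 1) $ i)"

text \<open>For an almost isometric map the frame determinant never vanishes, so its sign does not depend on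
  \<open>x\<close> and \<open>r\<close>; letting \<open>r\<close> tend to \<open>0\<close> one sees that it is the sign of the Jacobian.\<close>

definition oriented :: "real \<Rightarrow> (real^'n \<Rightarrow> real^'n) \<Rightarrow> bool" where
  "oriented s f \<longleftrightarrow> (\<forall>x r. r > 0 \<longrightarrow> sgn (frame_det f x r) = s)"

lemma near_isometric_continuous:
  fixes f :: "'a::real_normed_vector \<Rightarrow> 'b::real_normed_vector"
  assumes "near_isometric_on \<delta> UNIV f" "\<delta> \<ge> 0"
  shows "continuous_on UNIV f"
proof -
  have "norm (f x - f y) \<le> sqrt (1 + \<delta>) * norm (x - y)" for x y
    using assms real_sqrt_le_mono[of "(norm (f x - f y))\<^sup>2" "(1 + \<delta>) * (norm (x - y))\<^sup>2"]
    by (simp add: near_isometric_on_def real_sqrt_mult)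
  then have "(sqrt (1 + \<delta>))-lipschitz_on UNIV f"
    using assms by (intro lipschitz_onI) (auto simp: dist_norm)
  then show ?thesis by (rule lipschitz_on_continuous_on)
qed

text \<open>Gram-Schmidt applied to the rescaled images of the axes produces A, and
  \<open>rigidity\<close> carries the approximation from the axes to the unit ball. Tying
  \<open>det (matrix A)\<close> to the frame determinant lets the orientation of f pass to the
  approximating motion.\<close>

lemma near_isometric_local_motion:
  "\<exists>K\<ge>3. \<forall>\<delta> (f :: real^'n \<Rightarrow> real^'n) x r. 0 < \<delta> \<longrightarrow> K * \<delta> \<le> 1 \<longrightarrow> near_isometric_on \<delta> UNIV f \<longrightarrow> r > 0 \<longrightarrow>
     frame_det f x r \<noteq> 0 \<and>
     (\<exists>A. orthogonal_transformation A \<and> det (matrix A) = sgn (frame_det f x r) \<and>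
       (\<forall>v. norm v \<le> 1 \<longrightarrow> (norm (rescaled f x r v - A v))\<^sup>2 \<le> K * \<delta>))"
proof -
  obtain C where "C \<ge> 1" and GS: "\<And>(f :: 'n \<Rightarrow> real^'n) \<eta>. 0 \<le> \<eta> \<Longrightarrow> C * \<eta> \<le> 1 \<Longrightarrow>
    (\<forall>i\<in>UNIV. \<forall>j\<in>UNIV. \<bar>f i \<bullet> f j - (if i = j then 1 else 0)\<bar> \<le> \<eta>) \<Longrightarrow>
    (\<exists>a. (\<forall>i\<in>UNIV. \<forall>j\<in>UNIV. a i \<bullet> a j = (if i = j then 1 else 0)) \<and> (\<forall>i\<in>UNIV. norm (a i - f i) \<le> C * \<eta>))"
    using near_orthonormal_family[OF finite[of "UNIV :: 'n set"], where ?'a = "real^'n"] by blast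
  define N where "N = CARD('n)"
  have "N > 0" by (simp add: N_def)
  \<comment> \<open>The factors are the inner product error 3 * \<delta>, the loss C of Gram-Schmidt
    and the loss of \<open>rigidity\<close>. The bound on K * \<delta> also makes the frame close
    enough to A for the determinants to share their sign.\<close>
  define K where "K = (6 * real N + 7) * (3 * C)"
  show ?thesis
  proof (intro exI[of _ K] conjI allI impI)
    have "1 * 3 \<le> (6 * real N + 7) * (3 * C)"
      using \<open>C \<ge> 1\<close> by (intro mult_mono) auto
    then show "K \<ge> 3" by (simp add: K_def)
    fix \<delta> r :: real and f :: "real^'n \<Rightarrow> real^'n" and x
    assume \<delta>: "0 < \<delta>" "K * \<delta> \<le> 1" and f: "near_isometric_on \<delta> UNIV f" and "r > 0"
    let ?W = "rescaled f x r"
    define \<eta> where "\<eta> = C * (3 * \<delta>)"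
    have K\<eta>: "K * \<delta> = 6 * (N * \<eta>) + 7 * \<eta>"
      by (simp add: K_def \<eta>_def algebra_simps)
    have "\<eta> > 0" using \<delta> \<open>C \<ge> 1\<close> by (simp add: \<eta>_def)
    then have "N * \<eta> > 0" using \<open>N > 0\<close> by simp
    have "\<eta> \<le> 1" "N * \<eta> < 1"
      using \<delta>(2) K\<eta> \<open>\<eta> > 0\<close> \<open>N * \<eta> > 0\<close> by linarith+
    have "3 * \<delta> \<le> \<eta>"
      unfolding \<eta>_def using \<open>C \<ge> 1\<close> \<delta> mult_right_mono[of 1 C "3 * \<delta>"] by simp
    have inner: "\<bar>?W u \<bullet> ?W v - u \<bullet> v\<bar> \<le> 3 * \<delta>" if "norm u \<le> 1" "norm v \<le> 1" for u v
      using that \<delta> \<open>r > 0\<close> by (intro rescaled_inner[OF f]) auto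
    have axes: "axis i (1::real) \<bullet> axis j 1 = (if i = j then 1 else 0)" for i j :: 'n
      by (simp add: inner_axis) (simp add: axis_def)
    have "\<bar>?W (axis i 1) \<bullet> ?W (axis j 1) - (if i = j then 1 else 0)\<bar> \<le> 3 * \<delta>" for i j
      using inner[of "axis i 1" "axis j 1"] by (simp only: axes norm_axis_1)
    then obtain a where a: "\<And>i j. a i \<bullet> a j = (if i = j then 1 else 0)"
      and aW: "\<And>i. norm (a i - ?W (axis i 1)) \<le> \<eta>"
      using GS[of "3 * \<delta>" "\<lambda>i. ?W (axis i 1)"] \<delta> \<open>\<eta> \<le> 1\<close> by (auto simp: \<eta>_def)
    define A where "A = (\<lambda>x. \<Sum>i\<in>UNIV. x $ i *\<^sub>R a i)"
    have A: "orthogonal_transformation A"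
      unfolding A_def by (rule orthogonal_transformation_of_orthonormal[OF a])
    have Aa: "A (axis i 1) = a i" for i
      by (simp add: A_def axis_def if_distrib[of "\<lambda>x. x *\<^sub>R _"] cong: if_cong)
    have WA: "norm (?W (axis i 1) - A (axis i 1)) \<le> \<eta>" for i
      using aW[of i] by (simp add: Aa norm_minus_commute)
    note det = sgn_det_near_orthogonal[OF A WA, folded frame_det_def, folded N_def, OF \<open>N * \<eta> < 1\<close>]
    show "frame_det f x r \<noteq> 0" by (rule det(1))
    have "det (matrix A) = 1 \<or> det (matrix A) = - 1"
      using orthogonal_transformation_det[OF A] by linarith
    then have "det (matrix A) = sgn (frame_det f x r)"
      unfolding det(2) by auto
    moreover have "(norm (?W v - A v))\<^sup>2 \<le> K * \<delta>" if v: "norm v \<le> 1" for v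
    proof -
      have "(norm (?W v - A v))\<^sup>2 \<le> (6 * real N + 7) * \<eta>"
      proof (rule rigidity[OF A finite[of UNIV], where W = ?W and v = v and c = "($) v" and r = 0
              and f = "\<lambda>i. axis i 1"])
        show "v = (\<Sum>i\<in>UNIV. v $ i *\<^sub>R axis i 1) + 0"
          using basis_expansion[of v] by (simp add: scalar_mult_eq_scaleR)
        show "\<bar>v $ i\<bar> \<le> 1" for i
          using component_le_norm_cart[of v i] v by linarith
        show "\<bar>?W v \<bullet> ?W v - v \<bullet> v\<bar> \<le> \<eta>" "\<bar>?W v \<bullet> ?W (axis i 1) - v \<bullet> axis i 1\<bar> \<le> \<eta>" for i
          using inner[OF v v] inner[OF v, of "axis i 1"] \<open>3 * \<delta> \<le> \<eta>\<close> by auto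
      qed (use \<open>\<eta> > 0\<close> \<open>\<eta> \<le> 1\<close> v WA in \<open>auto simp: N_def\<close>)
      also have "\<dots> = K * \<delta>" using K\<eta> by (simp add: algebra_simps)
      finally show ?thesis .
    qed
    ultimately show "\<exists>A. orthogonal_transformation A \<and> det (matrix A) = sgn (frame_det f x r) \<and>
       (\<forall>v. norm v \<le> 1 \<longrightarrow> (norm (?W v - A v))\<^sup>2 \<le> K * \<delta>)"
      using A by blast
  qed
qed

lemma near_isometric_oriented:
  fixes f :: "real^'n \<Rightarrow> real^'n"
  assumes f: "near_isometric_on \<delta> UNIV f" "\<delta> \<ge> 0"
    and nz: "\<And>x r. r > 0 \<Longrightarrow> frame_det f x r \<noteq> 0"
  shows "oriented 1 f \<or> oriented (- 1) f"
proof -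
  have cf: "continuous_on UNIV f" by (rule near_isometric_continuous[OF f])
  have "continuous_on (UNIV \<times> {0<..}) (\<lambda>p. rescaled f (fst p) (snd p) v)" for v
  proof -
    have "continuous_on (UNIV \<times> {0<..}) (\<lambda>p. fst p + snd p *\<^sub>R v)"
      by (intro continuous_intros)
    then have 1: "continuous_on (UNIV \<times> {0<..}) (\<lambda>p. f (fst p + snd p *\<^sub>R v))"
      by (rule continuous_on_compose2[OF cf _ subset_UNIV])
    have 2: "continuous_on (UNIV \<times> {0::real<..}) (\<lambda>p. f (fst p))"
      by (rule continuous_on_compose2[OF cf continuous_on_fst[OF continuous_on_id] subset_UNIV])
    have "continuous_on (UNIV \<times> {0<..}) (\<lambda>p::(real^'n) \<times> real. inverse (snd p))"
      by (rule continuous_on_inverse[OF continuous_on_snd[OF continuous_on_id]]) auto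
    from continuous_on_scaleR[OF this continuous_on_diff[OF 1 2]] show ?thesis
      unfolding rescaled_def .
  qed
  then have cont: "continuous_on (UNIV \<times> {0<..}) (\<lambda>p. frame_det f (fst p) (snd p))"
    unfolding frame_det_def
    by (intro continuous_on_det) (simp only: vec_lambda_beta, rule continuous_on_component)
  have conn: "connected (UNIV \<times> {0::real<..} :: ((real^'n) \<times> real) set)"
    by (rule convex_connected[OF convex_Times[OF convex_UNIV convex_real_interval(3)]])
  have "frame_det f (fst p) (snd p) \<noteq> 0" if "p \<in> UNIV \<times> {0<..}" for p
    using nz[of "snd p" "fst p"] that by auto
  from sgn_eq_on_connected[OF conn cont this]
  have eq: "sgn (frame_det f x r) = sgn (frame_det f 0 1)" if "r > 0" for x r
    using that by fastforce
  have "sgn (frame_det f 0 1) = 1 \<or> sgn (frame_det f 0 1) = - 1"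
    using nz[of 1 0] by (auto simp: sgn_if)
  then show ?thesis
  proof
    assume "sgn (frame_det f 0 1) = 1"
    then have "oriented 1 f" unfolding oriented_def using eq by metis
    then show ?thesis ..
  next
    assume "sgn (frame_det f 0 1) = - 1"
    then have "oriented (- 1) f" unfolding oriented_def using eq by metis
    then show ?thesis ..
  qed
qed

text \<open>The motion approximating \<open>\<phi>\<close> on \<open>S\<close> is that of any extension of \<open>\<phi>\<close> from a barycentric
  spanner of \<open>S\<close>, and so is its orientation.\<close>

lemma approximating_motion:
  "\<exists>C\<ge>1. \<forall>\<delta>. 0 < \<delta> \<longrightarrow> C * \<delta> \<le> 1 \<longrightarrow>
    (\<forall>f :: real^'n \<Rightarrow> real^'n. near_isometric_on \<delta> UNIV f \<longrightarrow> oriented 1 f \<or> oriented (- 1) f) \<and>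
    (\<forall>(\<phi> :: real^'n \<Rightarrow> real^'n) S x R. finite S \<longrightarrow> x \<in> S \<longrightarrow> S \<subseteq> cball x R \<longrightarrow> R > 0 \<longrightarrow>
      near_isometric_on \<delta> S \<phi> \<longrightarrow>
      (\<exists>S0\<subseteq>S. card S0 \<le> CARD('n) + 1 \<and>
        (\<forall>f s. near_isometric_on \<delta> UNIV f \<longrightarrow> oriented s f \<longrightarrow> (\<forall>y\<in>S0. f y = \<phi> y) \<longrightarrow>
          (\<exists>A. orthogonal_transformation A \<and> det (matrix A) = s \<and>
            (\<forall>y\<in>S. (norm (\<phi> y - \<phi> x - A (y - x)))\<^sup>2 \<le> C * sqrt \<delta> * R\<^sup>2)))))"
proof -
  obtain K where "K \<ge> 3" and local: "\<And>\<delta> (f :: real^'n \<Rightarrow> real^'n) x r. 0 < \<delta> \<Longrightarrow> K * \<delta> \<le> 1 \<Longrightarrow>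
     near_isometric_on \<delta> UNIV f \<Longrightarrow> r > 0 \<Longrightarrow> frame_det f x r \<noteq> 0 \<and>
     (\<exists>A. orthogonal_transformation A \<and> det (matrix A) = sgn (frame_det f x r) \<and>
       (\<forall>v. norm v \<le> 1 \<longrightarrow> (norm (rescaled f x r v - A v))\<^sup>2 \<le> K * \<delta>))"
    using near_isometric_local_motion[where ?'n = 'n] by blast
  define N where "N = CARD('n)"
  define C where "C = (6 * real N + 7) * K"
  have "1 * K \<le> (6 * real N + 7) * K" using \<open>K \<ge> 3\<close> by (intro mult_right_mono) auto
  then have "K \<le> C" by (simp add: C_def)
  show ?thesis
  proof (intro exI[of _ C] conjI allI impI)
    show "1 \<le> C" using \<open>K \<le> C\<close> \<open>K \<ge> 3\<close> by simp
    fix \<delta> :: real assume \<delta>: "0 < \<delta>" "C * \<delta> \<le> 1"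
    have K\<delta>: "K * \<delta> \<le> 1" using mult_right_mono[OF \<open>K \<le> C\<close> less_imp_le[OF \<delta>(1)]] \<delta>(2) by linarith
    show "oriented 1 f \<or> oriented (- 1) f" if "near_isometric_on \<delta> UNIV f" for f :: "real^'n \<Rightarrow> real^'n"
      using local[OF \<delta>(1) K\<delta> that] \<delta> by (intro near_isometric_oriented[OF that]) auto
    fix \<phi> :: "real^'n \<Rightarrow> real^'n" and S x and R :: real
    assume S: "finite S" "x \<in> S" "S \<subseteq> cball x R" "R > 0" and \<phi>: "near_isometric_on \<delta> S \<phi>"
    \<comment> \<open>The error of the local motion of an extension. Applying
      \<open>rigidity\<close> again bounds a square by a multiple of \<eta>, so the final squared
      error is of order sqrt \<delta>.\<close>
    define \<eta> where "\<eta> = sqrt (K * \<delta>)"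
    have "K * \<delta> > 0" using \<delta> \<open>K \<ge> 3\<close> by simp
    then have \<eta>: "0 < \<eta>" "\<eta> \<le> 1" "\<eta>\<^sup>2 = K * \<delta>" using K\<delta> by (simp_all add: \<eta>_def)
    have "3 * \<delta> \<le> \<eta>"
    proof -
      have "3 * \<delta> \<le> \<eta>\<^sup>2" using \<eta> mult_right_mono[OF \<open>K \<ge> 3\<close>, of \<delta>] \<delta> by simp
      also have "\<dots> \<le> \<eta>" using \<eta> mult_left_le[of \<eta> \<eta>] by (simp add: power2_eq_square)
      finally show ?thesis .
    qed
    define V where "V = (\<lambda>y. (1 / R) *\<^sub>R (y - x)) ` S"
    have S_V: "x + R *\<^sub>R v \<in> S" if "v \<in> V" for v
      using that \<open>R > 0\<close> by (auto simp: V_def)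
    have norm_V: "norm v \<le> 1" if "v \<in> V" for v
      using that S by (auto simp: V_def dist_norm norm_minus_commute)
    \<comment> \<open>With short vectors of length \<eta> / N, the spanner's remainder has norm at
      most \<eta>, as \<open>rigidity\<close> requires.\<close>
    have "finite V" "\<eta> / real N > 0"
      using S \<eta> by (simp_all add: V_def N_def)
    then obtain f :: "'n \<Rightarrow> real^'n" and I where fV: "f ` I \<subseteq> V" and span: "\<And>v. v \<in> V \<Longrightarrow>
      \<exists>c r. v = (\<Sum>i\<in>I. c i *\<^sub>R f i) + r \<and> (\<forall>i. \<bar>c i\<bar> \<le> 1) \<and> norm r \<le> CARD('n) * (\<eta> / real N)"
      by (rule barycentric_spanner) (rule that)
    \<comment> \<open>The spanner in the original coordinates, with the base point of the blow-up
      added: at most one point more than the dimension. It is chosen before the extension and its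
      sign, so spanners of different sets can be combined.\<close>
    define S0 where "S0 = insert x ((\<lambda>i. x + R *\<^sub>R f i) ` I)"
    show "\<exists>S0\<subseteq>S. card S0 \<le> CARD('n) + 1 \<and>
        (\<forall>f s. near_isometric_on \<delta> UNIV f \<longrightarrow> oriented s f \<longrightarrow> (\<forall>y\<in>S0. f y = \<phi> y) \<longrightarrow>
          (\<exists>A. orthogonal_transformation A \<and> det (matrix A) = s \<and>
            (\<forall>y\<in>S. (norm (\<phi> y - \<phi> x - A (y - x)))\<^sup>2 \<le> C * sqrt \<delta> * R\<^sup>2)))"
    proof (intro exI[of _ S0] conjI allI impI)
      show "S0 \<subseteq> S" using S_V fV S by (auto simp: S0_def)
      have "card I \<le> CARD('n)" by (intro card_mono) auto
      then have "card ((\<lambda>i. x + R *\<^sub>R f i) ` I) \<le> CARD('n)"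
        using card_image_le[of I "\<lambda>i. x + R *\<^sub>R f i"] by simp
      then show "card S0 \<le> CARD('n) + 1"
        unfolding S0_def using card_insert_le_m1[of "CARD('n) + 1" "(\<lambda>i. x + R *\<^sub>R f i) ` I" x] by simp
      fix g :: "real^'n \<Rightarrow> real^'n" and s
      assume g: "near_isometric_on \<delta> UNIV g" "oriented s g" "\<forall>y\<in>S0. g y = \<phi> y"
      obtain A where A: "orthogonal_transformation A" "det (matrix A) = s"
        and gA: "\<And>v. norm v \<le> 1 \<Longrightarrow> (norm (rescaled g x R v - A v))\<^sup>2 \<le> \<eta>\<^sup>2"
        using local[OF \<delta>(1) K\<delta> g(1) \<open>R > 0\<close>, of x] g(2) \<open>R > 0\<close> unfolding oriented_def \<eta>(3) by auto
      let ?W = "rescaled \<phi> x R"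
      have W_approx: "(norm (?W v - A v))\<^sup>2 \<le> (6 * real N + 7) * \<eta>" if "v \<in> V" for v
      proof -
        obtain c r where cr: "v = (\<Sum>i\<in>I. c i *\<^sub>R f i) + r" "\<forall>i. \<bar>c i\<bar> \<le> 1" "norm r \<le> \<eta>"
          using span[OF \<open>v \<in> V\<close>] by (auto simp: N_def)
        have inner: "\<bar>?W v \<bullet> ?W u - v \<bullet> u\<bar> \<le> \<eta>" if "u \<in> V" for u
          using rescaled_inner[OF \<phi> \<open>x \<in> S\<close> S_V[OF \<open>v \<in> V\<close>] S_V[OF \<open>u \<in> V\<close>]] norm_V \<open>v \<in> V\<close> that
            \<delta> \<open>R > 0\<close> \<open>3 * \<delta> \<le> \<eta>\<close> by force
        show ?thesis
        proof (rule rigidity[OF A(1) finite[of I], where W = ?W and v = v and c = c and r = r and f = f])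
          show "card I \<le> N" using \<open>card I \<le> CARD('n)\<close> by (simp add: N_def)
          fix i assume "i \<in> I"
          have "?W (f i) = rescaled g x R (f i)"
            using g(3) \<open>i \<in> I\<close> by (simp add: rescaled_def S0_def)
          then show "norm (?W (f i) - A (f i)) \<le> \<eta>"
            using gA[of "f i"] fV norm_V \<open>i \<in> I\<close> \<eta>(1) by (auto intro: power2_le_imp_le)
          show "\<bar>?W v \<bullet> ?W (f i) - v \<bullet> f i\<bar> \<le> \<eta>"
            using inner fV \<open>i \<in> I\<close> by auto
        qed (use cr \<eta> inner[OF that] norm_V[OF that] in auto)
      qed
      have sqrtK: "sqrt K \<le> K"
        using \<open>K \<ge> 3\<close> by (intro real_le_lsqrt) (auto simp: power2_eq_square)
      have final: "(norm (\<phi> y - \<phi> x - A (y - x)))\<^sup>2 \<le> C * sqrt \<delta> * R\<^sup>2" if "y \<in> S" for y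
      proof -
        let ?v = "(1 / R) *\<^sub>R (y - x)"
        have "A ?v = (1 / R) *\<^sub>R A (y - x)"
          by (rule linear_scale[OF orthogonal_transformation_linear[OF A(1)]])
        then have "R *\<^sub>R (?W ?v - A ?v) = \<phi> y - \<phi> x - A (y - x)"
          using \<open>R > 0\<close> by (simp add: rescaled_def scaleR_diff_right)
        then have "(norm (\<phi> y - \<phi> x - A (y - x)))\<^sup>2 = R\<^sup>2 * (norm (?W ?v - A ?v))\<^sup>2"
          by (metis norm_scaleR power2_abs power_mult_distrib)
        also have "\<dots> \<le> R\<^sup>2 * ((6 * real N + 7) * \<eta>)"
          using W_approx[of ?v] that by (intro mult_left_mono) (auto simp: V_def)
        also have "\<eta> \<le> K * sqrt \<delta>"
          using mult_right_mono[OF sqrtK, of "sqrt \<delta>"] \<delta> by (simp add: \<eta>_def real_sqrt_mult)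
        then have "R\<^sup>2 * ((6 * real N + 7) * \<eta>) \<le> R\<^sup>2 * ((6 * real N + 7) * (K * sqrt \<delta>))"
          by (intro mult_left_mono) auto
        also have "\<dots> = C * sqrt \<delta> * R\<^sup>2" by (simp add: C_def)
        finally show ?thesis by simp
      qed
      show "\<exists>A. orthogonal_transformation A \<and> det (matrix A) = s \<and>
            (\<forall>y\<in>S. (norm (\<phi> y - \<phi> x - A (y - x)))\<^sup>2 \<le> C * sqrt \<delta> * R\<^sup>2)"
        using A final by blast
    qed
  qed
qed

section \<open>Gluing clusters\<close>

text \<open>The sign s stands outside the quantifier over clusters: one orientation has to serve all
  of them. The error is measured against the smallest distance m, the scale at which slides can
  correct it, while \<Lambda> bounds the ratio of the diameter to m.\<close>

definition approx_motions ::
  "(real^'n \<Rightarrow> real^'n) \<Rightarrow> (real^'n) set \<Rightarrow> real \<Rightarrow> real \<Rightarrow> real \<Rightarrow> bool" where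
  "approx_motions \<phi> E s \<Lambda> \<theta> \<longleftrightarrow> (\<forall>S m x. S \<subseteq> E \<longrightarrow> m > 0 \<longrightarrow> x \<in> S \<longrightarrow>
     (\<forall>y\<in>S. \<forall>z\<in>S. y \<noteq> z \<longrightarrow> m \<le> norm (y - z) \<and> norm (y - z) \<le> \<Lambda> * m) \<longrightarrow>
     (\<exists>A. orthogonal_transformation A \<and> det (matrix A) = s \<and>
       (\<forall>y\<in>S. norm (\<phi> y - \<phi> x - A (y - x)) \<le> \<theta> * m)))"

lemma near_isometric_on_subset: "near_isometric_on \<delta> T f \<Longrightarrow> S \<subseteq> T \<Longrightarrow> near_isometric_on \<delta> S f"
  unfolding near_isometric_on_def by blast

text \<open>If both orientations failed, each on its own set, then an extension from the union of the two
  spanners, which has at most \<open>2 * (CARD('n) + 1)\<close> points, could have no orientation at all.\<close>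

lemma approx_motions_exist:
  "\<exists>C\<ge>1. \<forall>\<delta> \<Lambda> \<theta> E (\<phi> :: real^'n \<Rightarrow> real^'n). 0 < \<delta> \<longrightarrow> C * \<delta> \<le> 1 \<longrightarrow> 1 \<le> \<Lambda> \<longrightarrow> 0 \<le> \<theta> \<longrightarrow>
     C * sqrt \<delta> * \<Lambda>\<^sup>2 \<le> \<theta>\<^sup>2 \<longrightarrow> finite E \<longrightarrow>
     (\<forall>E0\<subseteq>E. card E0 \<le> 2 * CARD('n) + 2 \<longrightarrow> (\<exists>f. near_isometric_on \<delta> UNIV f \<and> (\<forall>x\<in>E0. f x = \<phi> x))) \<longrightarrow>
     approx_motions \<phi> E 1 \<Lambda> \<theta> \<or> approx_motions \<phi> E (- 1) \<Lambda> \<theta>"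
proof -
  obtain C where "C \<ge> 1" and C: "\<forall>\<delta>. 0 < \<delta> \<longrightarrow> C * \<delta> \<le> 1 \<longrightarrow>
    (\<forall>f :: real^'n \<Rightarrow> real^'n. near_isometric_on \<delta> UNIV f \<longrightarrow> oriented 1 f \<or> oriented (- 1) f) \<and>
    (\<forall>(\<phi> :: real^'n \<Rightarrow> real^'n) S x R. finite S \<longrightarrow> x \<in> S \<longrightarrow> S \<subseteq> cball x R \<longrightarrow> R > 0 \<longrightarrow>
      near_isometric_on \<delta> S \<phi> \<longrightarrow>
      (\<exists>S0\<subseteq>S. card S0 \<le> CARD('n) + 1 \<and>
        (\<forall>f s. near_isometric_on \<delta> UNIV f \<longrightarrow> oriented s f \<longrightarrow> (\<forall>y\<in>S0. f y = \<phi> y) \<longrightarrow>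
          (\<exists>A. orthogonal_transformation A \<and> det (matrix A) = s \<and>
            (\<forall>y\<in>S. (norm (\<phi> y - \<phi> x - A (y - x)))\<^sup>2 \<le> C * sqrt \<delta> * R\<^sup>2)))))"
    using approximating_motion[where ?'n = 'n] by (elim exE conjE) (rule that, assumption, assumption)
  show ?thesis
  proof (intro exI[of _ C] conjI allI impI \<open>C \<ge> 1\<close>)
    fix \<delta> \<Lambda> \<theta> :: real and E and \<phi> :: "real^'n \<Rightarrow> real^'n"
    assume \<delta>: "0 < \<delta>" "C * \<delta> \<le> 1" and \<Lambda>: "1 \<le> \<Lambda>" and \<theta>: "0 \<le> \<theta>" "C * sqrt \<delta> * \<Lambda>\<^sup>2 \<le> \<theta>\<^sup>2"
      and "finite E" and ext: "\<forall>E0\<subseteq>E. card E0 \<le> 2 * CARD('n) + 2 \<longrightarrow>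
        (\<exists>f. near_isometric_on \<delta> UNIV f \<and> (\<forall>x\<in>E0. f x = \<phi> x))"
    note orientation = C[rule_format, OF \<delta>, THEN conjunct1, rule_format]
    note spanner = C[rule_format, OF \<delta>, THEN conjunct2, rule_format]
    \<comment> \<open>Near-isometry concerns two points at a time, and pairs are among the subsets
      with an extension.\<close>
    have "near_isometric_on \<delta> E \<phi>"
      unfolding near_isometric_on_def
    proof (intro ballI)
      fix x y assume "x \<in> E" "y \<in> E"
      then have "{x, y} \<subseteq> E" by simp
      moreover have "card {x, y} \<le> 2 * CARD('n) + 2"
        by (rule order_trans[of _ 2]) (auto simp: card_insert_if)
      ultimately obtain f where "near_isometric_on \<delta> UNIV f" "f x = \<phi> x" "f y = \<phi> y"
        using ext[rule_format, of "{x, y}"] by auto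
      then show "(norm (\<phi> x - \<phi> y))\<^sup>2 \<le> (1 + \<delta>) * (norm (x - y))\<^sup>2 \<and>
          (norm (x - y))\<^sup>2 \<le> (1 + \<delta>) * (norm (\<phi> x - \<phi> y))\<^sup>2"
        unfolding near_isometric_on_def by (metis UNIV_I)
    qed
    note near = near_isometric_on_subset[OF this]
    \<comment> \<open>If the sign s fails on some cluster, no extension from the spanner of that
      cluster can have sign s, since it would supply the missing motion.\<close>
    have witness: "\<exists>S0\<subseteq>E. card S0 \<le> CARD('n) + 1 \<and>
        (\<forall>f. near_isometric_on \<delta> UNIV f \<longrightarrow> (\<forall>y\<in>S0. f y = \<phi> y) \<longrightarrow> \<not> oriented s f)"
      if "\<not> approx_motions \<phi> E s \<Lambda> \<theta>" for s
    proof -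
      obtain S m x where S: "S \<subseteq> E" "m > 0" "x \<in> S"
        and sep: "\<And>y z. y \<in> S \<Longrightarrow> z \<in> S \<Longrightarrow> y \<noteq> z \<Longrightarrow> m \<le> norm (y - z) \<and> norm (y - z) \<le> \<Lambda> * m"
        and no: "\<not> (\<exists>A. orthogonal_transformation A \<and> det (matrix A) = s \<and>
          (\<forall>y\<in>S. norm (\<phi> y - \<phi> x - A (y - x)) \<le> \<theta> * m))"
        using \<open>\<not> approx_motions \<phi> E s \<Lambda> \<theta>\<close> unfolding approx_motions_def by blast
      have pos: "\<Lambda> * m > 0" using \<Lambda> \<open>m > 0\<close> by simp
      have "S \<subseteq> cball x (\<Lambda> * m)"
      proof
        fix y assume "y \<in> S"
        then show "y \<in> cball x (\<Lambda> * m)"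
          using sep[OF \<open>x \<in> S\<close> \<open>y \<in> S\<close>] pos by (cases "x = y") (auto simp: dist_norm)
      qed
      then obtain S0 where "S0 \<subseteq> S" "card S0 \<le> CARD('n) + 1"
        and S0: "\<forall>f s. near_isometric_on \<delta> UNIV f \<longrightarrow> oriented s f \<longrightarrow> (\<forall>y\<in>S0. f y = \<phi> y) \<longrightarrow>
            (\<exists>A. orthogonal_transformation A \<and> det (matrix A) = s \<and>
              (\<forall>y\<in>S. (norm (\<phi> y - \<phi> x - A (y - x)))\<^sup>2 \<le> C * sqrt \<delta> * (\<Lambda> * m)\<^sup>2))"
        using spanner[OF finite_subset[OF S(1) \<open>finite E\<close>] S(3) _ pos near[OF S(1)]] by blast
      have "\<not> oriented s f" if f: "near_isometric_on \<delta> UNIV f" "\<forall>y\<in>S0. f y = \<phi> y" for f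
      proof
        assume "oriented s f"
        then obtain A where A: "orthogonal_transformation A" "det (matrix A) = s"
          and bound: "\<And>y. y \<in> S \<Longrightarrow> (norm (\<phi> y - \<phi> x - A (y - x)))\<^sup>2 \<le> C * sqrt \<delta> * (\<Lambda> * m)\<^sup>2"
          using S0[rule_format, OF f(1) _ f(2)[rule_format]] by blast
        have "C * sqrt \<delta> * (\<Lambda> * m)\<^sup>2 \<le> (\<theta> * m)\<^sup>2"
          using mult_right_mono[OF \<theta>(2), of "m\<^sup>2"] by (simp add: power_mult_distrib mult_ac)
        then have "norm (\<phi> y - \<phi> x - A (y - x)) \<le> \<theta> * m" if "y \<in> S" for y
          using power2_le_imp_le[OF order_trans[OF bound[OF that]]] \<theta>(1) \<open>m > 0\<close> by simp
        then show False using no A by blast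
      qed
      then show ?thesis
        using \<open>S0 \<subseteq> S\<close> S(1) \<open>card S0 \<le> CARD('n) + 1\<close> by (intro exI[of _ S0]) auto
    qed
    show "approx_motions \<phi> E 1 \<Lambda> \<theta> \<or> approx_motions \<phi> E (- 1) \<Lambda> \<theta>"
    proof (rule ccontr)
      assume "\<not> ?thesis"
      then have "\<not> approx_motions \<phi> E 1 \<Lambda> \<theta>" "\<not> approx_motions \<phi> E (- 1) \<Lambda> \<theta>" by auto
      note this[THEN witness]
      then obtain S1 S2 where
        S1: "S1 \<subseteq> E" "card S1 \<le> CARD('n) + 1"
          "\<forall>f. near_isometric_on \<delta> UNIV f \<longrightarrow> (\<forall>y\<in>S1. f y = \<phi> y) \<longrightarrow> \<not> oriented 1 f" and
        S2: "S2 \<subseteq> E" "card S2 \<le> CARD('n) + 1"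
          "\<forall>f. near_isometric_on \<delta> UNIV f \<longrightarrow> (\<forall>y\<in>S2. f y = \<phi> y) \<longrightarrow> \<not> oriented (- 1) f"
        by (elim exE conjE)
      have "card (S1 \<union> S2) \<le> 2 * CARD('n) + 2"
        using card_Un_le[of S1 S2] S1(2) S2(2) by linarith
      then obtain f where "near_isometric_on \<delta> UNIV f" "\<forall>x\<in>S1 \<union> S2. f x = \<phi> x"
        using ext[rule_format, of "S1 \<union> S2"] S1(1) S2(1) by blast
      then show False using orientation[of f] S1(3) S2(3) by blast
    qed
  qed
qed

lemma almost_isometric_diffeo_translate:
  fixes T :: "real^'n \<Rightarrow> real^'n"
  assumes "almost_isometric_diffeo K T" "K \<ge> 0"
  shows "almost_isometric_diffeo K (\<lambda>u. x + T (u - x))"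
proof -
  note iso = almost_isometric_diffeo_isometry[OF orthogonal_transformation_id]
  have "almost_isometric_diffeo (1 * (K * 1)) ((\<lambda>u. x + (u - 0)) \<circ> (T \<circ> (\<lambda>u. 0 + (u - x))))"
    using assms(2) by (intro almost_isometric_diffeo_compose iso assms(1)) auto
  then show ?thesis by (simp add: o_def)
qed

text \<open>Pigeonhole: the k half-open shells are disjoint, and fewer than k points cannot meet
  them all.\<close>

lemma exists_empty_scale:
  fixes d :: "'a \<Rightarrow> real"
  assumes "finite Z" "card Z < k" "m > 0" "l > 1"
  shows "\<exists>j<k. \<forall>z\<in>Z. \<not> (m * l ^ j < d z \<and> d z \<le> m * l ^ Suc j)"
proof (rule ccontr)
  assume "\<not> ?thesis"
  then obtain z where z: "\<And>j. j < k \<Longrightarrow> z j \<in> Z \<and> m * l ^ j < d (z j) \<and> d (z j) \<le> m * l ^ Suc j"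
    by metis
  have "z i \<noteq> z j" if "i < j" "j < k" for i j
  proof -
    have "l ^ Suc i \<le> l ^ j" using that \<open>l > 1\<close> by (intro power_increasing) auto
    then have "m * l ^ Suc i \<le> m * l ^ j" using \<open>m > 0\<close> by simp
    then show ?thesis using z[of i] z[of j] that by force
  qed
  then have "inj_on z {..<k}"
    by (intro inj_onI) (metis lessThan_iff linorder_neqE_nat)
  moreover have "z ` {..<k} \<subseteq> Z" using z by auto
  ultimately have "card {..<k} \<le> card Z" using card_inj_on_le assms(1) by blast
  then show False using assms(2) by simp
qed

text \<open>Induction from coarse to fine. The points around a closest pair form a cluster that is isolated at
  some scale; it is collapsed to one point, and afterwards the extension, which is a motion near
  that point, is first twisted to the motion suited to the cluster and then slid into place at each
  of its points.\<close>

lemma extension_by_clusters: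
  fixes \<phi> :: "real^'n \<Rightarrow> real^'n"
  assumes "finite E" "card E \<le> k" and \<eta>: "0 < \<eta>" "\<eta> \<le> 1" and b: "512 / \<eta> \<le> b"
    and motions: "approx_motions \<phi> E s (2 * (32 * exp b) ^ k) (\<eta> / (64 * k))"
    and s: "s \<noteq> 0" and "F \<subseteq> E" "F \<noteq> {}"
  shows "\<exists>\<Phi>. almost_isometric_diffeo ((1 + \<eta>) ^ ((CARD('n) + 1) * card F)) \<Phi> \<and> (\<forall>x\<in>F. \<Phi> x = \<phi> x) \<and>
    (\<forall>x\<in>F. \<forall>r>0. (\<forall>z\<in>F - {x}. 8 * r \<le> norm (x - z)) \<longrightarrow>
      (\<exists>A. orthogonal_transformation A \<and> det (matrix A) = s \<and> (\<forall>u\<in>cball x r. \<Phi> u = \<phi> x + A (u - x))))"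
  using \<open>F \<subseteq> E\<close> \<open>F \<noteq> {}\<close>
\<comment> \<open>The local clause is what feeds the recursion: it makes the coarser extension an
  exact motion around a collapsed cluster. Each stage costs \<open>CARD('n)\<close> factors for the
  twist and one for the slides.\<close>
proof (induction "card F" arbitrary: F rule: less_induct)
  case less
  have finF: "finite F" using less.prems \<open>finite E\<close> finite_subset by blast
  have "card F \<le> k" using card_mono[OF \<open>finite E\<close> less.prems(1)] \<open>card E \<le> k\<close> by simp
  have "b > 0" using b \<eta> by (smt (verit) divide_pos_pos)
  \<comment> \<open>The empty shell, from \<tau> to l * \<tau>, must contain the twist. It starts at
    radius 2 * \<tau>, below the radius l * \<tau> / 8 where the coarser map is a motion, and has
    ended at l * \<tau> / 2.\<close>
  define l where "l = 32 * exp b"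
  have l: "l \<ge> 32" using \<open>b > 0\<close> by (simp add: l_def)
  show ?case
  proof (cases "\<exists>x. F = {x}")
    case True
    then obtain x where "F = {x}" by blast
    then have "\<exists>A. orthogonal_transformation A \<and> det (matrix A) = s \<and>
        (\<forall>y\<in>{x}. norm (\<phi> y - \<phi> x - A (y - x)) \<le> \<eta> / (64 * k) * 1)"
      using less.prems by (intro motions[unfolded approx_motions_def, rule_format]) auto
    then obtain A :: "real^'n \<Rightarrow> real^'n" where "orthogonal_transformation A" "det (matrix A) = s"
      by blast
    then show ?thesis
      using \<open>F = {x}\<close> \<eta>
      by (intro exI[of _ "\<lambda>u. \<phi> x + A (u - x)"] conjI
          almost_isometric_diffeo_mono[OF almost_isometric_diffeo_isometry] one_le_power)
        (auto simp: linear_0[OF orthogonal_transformation_linear])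
  next
    case False
    define P where "P = {p \<in> F \<times> F. fst p \<noteq> snd p}"
    have "finite P" using finF by (simp add: P_def)
    obtain y where "y \<in> F" using less.prems(2) by blast
    moreover from this obtain z where "z \<in> F" "z \<noteq> y" using False by blast
    ultimately have "(y, z) \<in> P" by (simp add: P_def)
    then have "P \<noteq> {}" by blast
    define dd where "dd = (\<lambda>p :: (real^'n) \<times> (real^'n). norm (fst p - snd p))"
    have "Min (dd ` P) \<in> dd ` P" using \<open>finite P\<close> \<open>P \<noteq> {}\<close> by (intro Min_in) auto
    then obtain p where p: "p \<in> P" "dd p = Min (dd ` P)" by auto
    obtain x x' where "p = (x, x')" by (cases p)
    define m where "m = norm (x - x')"
    have x: "x \<in> F" "x' \<in> F" "x \<noteq> x'" using p \<open>p = (x, x')\<close> by (auto simp: P_def)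
    have m_le: "m \<le> norm (y - z)" if "y \<in> F" "z \<in> F" "y \<noteq> z" for y z
    proof -
      have "dd p \<le> dd (y, z)"
        unfolding p(2) using \<open>finite P\<close> that by (intro Min_le) (auto simp: P_def)
      then show ?thesis by (simp add: dd_def m_def \<open>p = (x, x')\<close>)
    qed
    have "m > 0" using x by (simp add: m_def)
    have "card (F - {x}) < k"
      using x(1) finF \<open>card F \<le> k\<close> by (metis card_Diff1_less order_less_le_trans)
    then obtain j where "j < k" and gap: "\<forall>z\<in>F - {x}. \<not> (m * l ^ j < norm (z - x) \<and> norm (z - x) \<le> m * l ^ Suc j)"
      using exists_empty_scale[of "F - {x}" k m l "\<lambda>z. norm (z - x)"] finF \<open>m > 0\<close> l by auto
    have "k \<ge> 1" using \<open>j < k\<close> by simp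
    define \<tau> where "\<tau> = m * l ^ j"
    have "1 \<le> l ^ j" using l by (intro one_le_power) auto
    then have \<tau>: "m \<le> \<tau>" "\<tau> > 0" using \<open>m > 0\<close> by (simp_all add: \<tau>_def)
    define S where "S = {y \<in> F. norm (y - x) \<le> \<tau>}"
    have far: "norm (z - x) > l * \<tau>" if "z \<in> F" "z \<notin> S" for z
    proof -
      have "z \<noteq> x" using that \<tau> by (auto simp: S_def)
      then have "\<not> (m * l ^ j < norm (z - x) \<and> norm (z - x) \<le> m * l ^ Suc j)"
        using gap that(1) by blast
      moreover have "m * l ^ j < norm (z - x)" using that by (simp add: S_def \<tau>_def)
      ultimately show ?thesis by (simp add: \<tau>_def mult_ac)
    qed
    have xS: "x \<in> S" "x' \<in> S" using x \<tau> by (auto simp: S_def m_def norm_minus_commute)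
    have "S \<subseteq> F" by (auto simp: S_def)
    have near: "norm (y - x) \<le> \<tau>" if "y \<in> S" for y using that by (simp add: S_def)
    \<comment> \<open>The cluster is represented by x alone; the partner x' of the closest pair is
      dropped, so F' is strictly smaller.\<close>
    define F' where "F' = insert x (F - S)"
    have F': "F' \<subseteq> F" "x \<in> F'" "x' \<notin> F'" using x xS by (auto simp: F'_def)
    then have card': "card F' < card F" using x finF by (intro psubset_card_mono) auto
    have F'_E: "F' \<subseteq> E" and F'_ne: "F' \<noteq> {}" using F' less.prems(1) by auto
    obtain \<Psi> where \<Psi>: "almost_isometric_diffeo ((1 + \<eta>) ^ ((CARD('n) + 1) * card F')) \<Psi>"
      and \<Psi>_eq: "\<forall>y\<in>F'. \<Psi> y = \<phi> y"
      and \<Psi>_all: "\<forall>y\<in>F'. \<forall>r>0. (\<forall>z\<in>F' - {y}. 8 * r \<le> norm (y - z)) \<longrightarrow>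
        (\<exists>A. orthogonal_transformation A \<and> det (matrix A) = s \<and> (\<forall>u\<in>cball y r. \<Psi> u = \<phi> y + A (u - y)))"
      using less.hyps[OF card' F'_E F'_ne] by (elim exE conjE) (rule that, assumption+)
    have \<Psi>_local: "\<exists>A. orthogonal_transformation A \<and> det (matrix A) = s \<and>
        (\<forall>u\<in>cball y r. \<Psi> u = \<phi> y + A (u - y))"
      if "y \<in> F'" "r > 0" "\<forall>z\<in>F' - {y}. 8 * r \<le> norm (y - z)" for y r
      using \<Psi>_all[THEN bspec, OF that(1), THEN spec, THEN mp, OF that(2), THEN mp, OF that(3)] .
    have "\<exists>A. orthogonal_transformation A \<and> det (matrix A) = s \<and> (\<forall>u\<in>cball x (l * \<tau> / 8). \<Psi> u = \<phi> x + A (u - x))"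
    proof (rule \<Psi>_local[OF F'(2)])
      show "l * \<tau> / 8 > 0" using l \<tau> by simp
      show "\<forall>z\<in>F' - {x}. 8 * (l * \<tau> / 8) \<le> norm (x - z)"
        using far by (auto simp: F'_def norm_minus_commute intro: less_imp_le)
    qed
    then obtain A' where A': "orthogonal_transformation A'" "det (matrix A') = s"
      and \<Psi>_x: "\<And>u. norm (u - x) \<le> l * \<tau> / 8 \<Longrightarrow> \<Psi> u = \<phi> x + A' (u - x)"
      by (auto simp: dist_norm norm_minus_commute)
    \<comment> \<open>Chosen for the slides: at most k of them, each displacement at most 8 *
      \<theta> times its radius, and k * 16 * \<theta> = \<eta> / 4.\<close>
    define \<theta> where "\<theta> = \<eta> / (64 * k)"
    have "\<theta> \<le> \<eta> / 64"
      unfolding \<theta>_def using \<open>k \<ge> 1\<close> \<eta> by (intro divide_left_mono) auto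
    then have \<theta>: "0 < \<theta>" "\<theta> \<le> 1 / 64" using \<eta> \<open>k \<ge> 1\<close> by (simp_all add: \<theta>_def)
    have "\<exists>A. orthogonal_transformation A \<and> det (matrix A) = s \<and>
       (\<forall>y\<in>S. norm (\<phi> y - \<phi> x - A (y - x)) \<le> \<theta> * m)"
      unfolding \<theta>_def
    proof (rule motions[unfolded approx_motions_def, rule_format])
      show "S \<subseteq> E" using \<open>S \<subseteq> F\<close> less.prems by simp
      fix y z assume yz: "y \<in> S" "z \<in> S" "y \<noteq> z"
      have "norm (y - z) \<le> 2 * \<tau>"
        using norm_triangle_ineq4[of "y - x" "z - x"] near[OF yz(1)] near[OF yz(2)] by simp
      also have "\<dots> \<le> 2 * l ^ k * m"
        using power_increasing[of j k l] \<open>j < k\<close> l \<open>m > 0\<close> by (simp add: \<tau>_def)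
      finally show "m \<le> norm (y - z) \<and> norm (y - z) \<le> 2 * (32 * exp b) ^ k * m"
        using m_le yz \<open>S \<subseteq> F\<close> by (auto simp: l_def)
    qed (use \<open>m > 0\<close> xS in auto)
    then obtain A where A: "orthogonal_transformation A" "det (matrix A) = s"
      and A_approx: "\<And>y. y \<in> S \<Longrightarrow> norm (\<phi> y - \<phi> x - A (y - x)) \<le> \<theta> * m"
      by blast
    have linA: "linear A" by (rule orthogonal_transformation_linear[OF A(1)])
    \<comment> \<open>The change of motion as seen in the domain. Both motions have determinant s,
      so B has determinant 1 for either sign and can be twisted.\<close>
    define B where "B = inv A' \<circ> A"
    have B: "orthogonal_transformation B"
      unfolding B_def by (intro orthogonal_transformation_compose orthogonal_transformation_inv A' A)
    have A'B: "A' (B v) = A v" for v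
      unfolding B_def using orthogonal_transformation_surj[OF A'(1)] by (simp add: surj_f_inv_f)
    then have "A' \<circ> B = A" by (simp add: fun_eq_iff)
    then have "det (matrix B) = 1"
      using det_orthogonal_compose[OF A'(1) B] A A' s by simp
    then obtain T where T: "almost_isometric_diffeo ((1 + \<eta>) ^ CARD('n)) T"
      and T_in: "\<And>v. norm v \<le> 2 * \<tau> \<Longrightarrow> T v = B v"
      and T_out: "\<And>v. 2 * exp b * (2 * \<tau>)\<^sup>2 \<le> (norm v)\<^sup>2 \<Longrightarrow> T v = v"
      using radial_twist_rotation[OF B] \<eta> b \<tau> unfolding radial_twist_def
      by (metis mult_pos_pos zero_less_numeral)
    define G1 where "G1 = (\<lambda>u. x + T (u - x))"
    \<comment> \<open>The remaining error, pulled back by A because the slide acts on the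
      argument.\<close>
    define w where "w = (\<lambda>y. inv A (\<phi> y - \<phi> x) - (y - x))"
    have Aw: "A (w y) = \<phi> y - \<phi> x - A (y - x)" for y
      using orthogonal_transformation_surj[OF A(1)]
      by (simp add: w_def linear_diff[OF linA] surj_f_inv_f)
    have w: "norm (w y) \<le> \<theta> * m" if "y \<in> S" for y
      using A_approx[OF that] orthogonal_transformation_norm[OF A(1), of "w y"] by (simp add: Aw)
    \<comment> \<open>The largest radius that the local clause can ask for at y. It is at least m /
      8, so displacements of size \<theta> * m are small relative to it.\<close>
    define \<rho> where "\<rho> = (\<lambda>y. Min ((\<lambda>z. norm (y - z)) ` (F - {y})) / 8)"
    have \<rho>_le: "8 * \<rho> y \<le> norm (y - z)" if "y \<in> F" "z \<in> F" "y \<noteq> z" for y z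
    proof -
      have "Min ((\<lambda>z. norm (y - z)) ` (F - {y})) \<le> norm (y - z)"
        using finF that by (intro Min_le) auto
      then show ?thesis by (simp add: \<rho>_def)
    qed
    have \<rho>_attained: "\<exists>z\<in>F - {y}. 8 * \<rho> y = norm (y - z)" if "y \<in> F" for y
    proof -
      have "F - {y} \<noteq> {}" using x by auto
      then have "Min ((\<lambda>z. norm (y - z)) ` (F - {y})) \<in> (\<lambda>z. norm (y - z)) ` (F - {y})"
        using finF by (intro Min_in) auto
      then show ?thesis by (auto simp: \<rho>_def)
    qed
    have \<rho>_ge: "m \<le> 8 * \<rho> y" if "y \<in> F" for y
    proof -
      obtain z where "z \<in> F - {y}" "8 * \<rho> y = norm (y - z)" using \<rho>_attained[OF \<open>y \<in> F\<close>] by blast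
      then show ?thesis using m_le[of y z] that by force
    qed
    have \<rho>_\<tau>: "8 * \<rho> y \<le> \<tau>" if "y \<in> S" for y
    proof (cases "y = x")
      case True
      then show ?thesis using \<rho>_le[of x x'] x \<tau> by (simp add: m_def)
    next
      case False
      then show ?thesis using \<rho>_le[of y x] near[OF that] x that by (auto simp: S_def)
    qed
    define G2 where "G2 = (\<lambda>u. u + (\<Sum>y\<in>S. log_cutoff (\<rho> y) 1 (u - y) *\<^sub>R w y))"
    have finS: "finite S" using finF \<open>S \<subseteq> F\<close> finite_subset by blast
    have \<rho>_pos: "\<rho> y > 0" if "y \<in> S" for y using \<rho>_ge[of y] \<open>m > 0\<close> \<open>S \<subseteq> F\<close> that by force
    \<comment> \<open>Slides need no long range of scales, so b = 1 is taken; then 2 * exp 1 < 9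
      gives a support of radius 3 * \<rho>, which avoids the balls around the other points.\<close>
    have cutoff_0: "log_cutoff (\<rho> y) 1 v = 0" if "y \<in> S" "3 * \<rho> y \<le> norm v" for y and v :: "real^'n"
    proof (rule log_cutoff_eq_0)
      have "2 * exp 1 * (\<rho> y)\<^sup>2 \<le> 9 * (\<rho> y)\<^sup>2"
        using exp_le by (intro mult_right_mono) auto
      also have "\<dots> = (3 * \<rho> y)\<^sup>2" by (simp add: power2_eq_square)
      also have "\<dots> \<le> (norm v)\<^sup>2" using that \<rho>_pos[of y] by (intro power_mono) auto
      finally show "2 * exp 1 * (\<rho> y)\<^sup>2 \<le> (norm v)\<^sup>2" .
    qed (use \<rho>_pos that in auto)
    have G2: "almost_isometric_diffeo (1 + \<eta>) G2"
      unfolding G2_def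
    proof (rule almost_isometric_diffeo_slides[OF finS \<rho>_pos])
      show "norm (w y) \<le> 8 * \<theta> * \<rho> y" if "y \<in> S" for y
      proof -
        have "m \<le> 8 * \<rho> y" using \<rho>_ge that \<open>S \<subseteq> F\<close> by blast
        then have "\<theta> * m \<le> \<theta> * (8 * \<rho> y)" using \<theta>(1) by simp
        then show ?thesis using w[OF that] by simp
      qed
      have "card S \<le> k" using card_mono[OF finF \<open>S \<subseteq> F\<close>] \<open>card F \<le> k\<close> by simp
      then have "card S * (16 * \<theta>) \<le> k * (16 * \<theta>)" using \<theta> by (intro mult_right_mono) auto
      also have "\<dots> = \<eta> / 4" using \<open>k \<ge> 1\<close> by (simp add: \<theta>_def)
      finally show "card S * (2 * (8 * \<theta>) / 1) \<le> \<eta> / 4" by simp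
    qed (use \<eta> in auto)
    \<comment> \<open>Near a point y of the cluster, the slide is the translation by
      \<open>w y\<close>, the twist acts as B and the coarser map as A', so the total is A with its
      error corrected.\<close>
    define \<Phi> where "\<Phi> = \<Psi> \<circ> (G1 \<circ> G2)"
    have G1: "almost_isometric_diffeo ((1 + \<eta>) ^ CARD('n)) G1"
      unfolding G1_def using T \<eta> by (intro almost_isometric_diffeo_translate) auto
    have "almost_isometric_diffeo ((1 + \<eta>) ^ ((CARD('n) + 1) * card F') * ((1 + \<eta>) ^ CARD('n) * (1 + \<eta>))) \<Phi>"
      unfolding \<Phi>_def using \<Psi> G1 G2 \<eta> by (intro almost_isometric_diffeo_compose) auto
    moreover have "(1 + \<eta>) ^ ((CARD('n) + 1) * card F') * ((1 + \<eta>) ^ CARD('n) * (1 + \<eta>))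
        = (1 + \<eta>) ^ ((CARD('n) + 1) * Suc (card F'))"
      by (simp add: power_add algebra_simps)
    moreover have "(1 + \<eta>) ^ ((CARD('n) + 1) * Suc (card F')) \<le> (1 + \<eta>) ^ ((CARD('n) + 1) * card F)"
      using \<eta> card' by (intro power_increasing mult_le_mono2) auto
    ultimately have \<Phi>: "almost_isometric_diffeo ((1 + \<eta>) ^ ((CARD('n) + 1) * card F)) \<Phi>"
      using almost_isometric_diffeo_mono by metis
    have l\<tau>: "32 * \<tau> \<le> l * \<tau>" using l \<tau> by (intro mult_right_mono) auto
    have inner: "\<Psi> (G1 u) = \<phi> x + A (u - x)" if "norm (u - x) \<le> 2 * \<tau>" for u
    proof -
      have "norm (G1 u - x) = norm (u - x)"
        using T_in[OF that] orthogonal_transformation_norm[OF B, of "u - x"] by (simp add: G1_def)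
      then have "norm (G1 u - x) \<le> l * \<tau> / 8" using that l\<tau> \<tau>(2) by linarith
      from \<Psi>_x[OF this] show ?thesis
        using T_in[OF that] A'B by (simp add: G1_def)
    qed
    have at_S: "\<Phi> u = \<phi> y + A (u - y)" if y: "y \<in> S" and u: "norm (u - y) \<le> \<rho> y" for u y
    proof -
      have "log_cutoff (\<rho> z) 1 (u - z) *\<^sub>R w z = (if z = y then w y else 0)" if "z \<in> S" for z
      proof (cases "z = y")
        case True
        then show ?thesis using log_cutoff_eq_1[of "\<rho> y" 1 "u - y"] u \<rho>_pos[OF y] by simp
      next
        case False
        have "8 * \<rho> y \<le> norm (y - z)" "8 * \<rho> z \<le> norm (y - z)"
          using \<rho>_le[of y z] \<rho>_le[of z y] y that False \<open>S \<subseteq> F\<close> by (auto simp: norm_minus_commute)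
        moreover have "norm (y - z) \<le> norm (u - z) + norm (u - y)"
          using norm_triangle_ineq4[of "u - z" "u - y"] by simp
        ultimately have "3 * \<rho> z \<le> norm (u - z)"
          using u \<rho>_pos[OF y] by linarith
        then show ?thesis using cutoff_0[OF that] False by simp
      qed
      then have "G2 u = u + w y"
        using y finS by (simp add: G2_def cong: sum.cong)
      moreover have "norm ((u + w y) - x) \<le> 2 * \<tau>"
      proof -
        have "norm ((u + w y) - x) = norm ((u - y) + (y - x) + w y)"
          by (simp add: algebra_simps)
        moreover have "\<theta> * m \<le> 1 / 64 * \<tau>" using \<theta> \<tau> \<open>m > 0\<close> by (intro mult_mono) auto
        ultimately show ?thesis
          using norm_triangle_ineq[of "(u - y) + (y - x)" "w y"] norm_triangle_ineq[of "u - y" "y - x"]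
            w[OF y] near[OF y] u \<rho>_\<tau>[OF y] \<tau> by linarith
      qed
      from inner[OF this] have "\<Psi> (G1 (u + w y)) = \<phi> x + A ((u - y) + (y - x) + w y)"
        by (simp add: algebra_simps)
      ultimately show ?thesis
        by (simp only: \<Phi>_def comp_apply linear_add[OF linA] Aw) simp
    qed
    have outer: "\<Phi> u = \<Psi> u" if u: "l * \<tau> / 2 \<le> norm (u - x)" for u
    proof -
      have "log_cutoff (\<rho> z) 1 (u - z) = 0" if "z \<in> S" for z
      proof (rule cutoff_0[OF that])
        have "norm (u - x) \<le> norm (u - z) + norm (z - x)"
          using norm_triangle_ineq[of "u - z" "z - x"] by simp
        then show "3 * \<rho> z \<le> norm (u - z)"
          using u l\<tau> near[OF that] \<rho>_\<tau>[OF that] \<tau>(2) by linarith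
      qed
      then have "G2 u = u" by (simp add: G2_def)
      have "1 \<le> exp b" using \<open>b > 0\<close> by simp
      then have "1 \<le> 32 * exp b" by linarith
      then have "8 * exp b \<le> 256 * (exp b * exp b)" by simp
      then have "8 * exp b * \<tau>\<^sup>2 \<le> 256 * (exp b * exp b) * \<tau>\<^sup>2"
        by (rule mult_right_mono) simp
      also have "\<dots> = (l * \<tau> / 2)\<^sup>2" by (simp add: l_def power2_eq_square)
      also have "\<dots> \<le> (norm (u - x))\<^sup>2"
        using u l \<tau> by (intro power_mono) auto
      finally have "T (u - x) = u - x" by (intro T_out) (simp add: power_mult_distrib)
      then show ?thesis using \<open>G2 u = u\<close> by (simp add: \<Phi>_def G1_def)
    qed
    have \<Phi>_eq: "\<Phi> y = \<phi> y" if "y \<in> F" for y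
    proof (cases "y \<in> S")
      case True
      then show ?thesis using at_S[of y y] \<rho>_pos[OF True] by (simp add: linear_0[OF linA])
    next
      case False
      then show ?thesis using outer[of y] far[OF that False] l\<tau> \<tau> \<Psi>_eq that by (simp add: F'_def)
    qed
    have \<Phi>_local: "\<exists>A. orthogonal_transformation A \<and> det (matrix A) = s \<and> (\<forall>u\<in>cball y r. \<Phi> u = \<phi> y + A (u - y))"
      if "y \<in> F" "r > 0" and r: "\<forall>z\<in>F - {y}. 8 * r \<le> norm (y - z)" for y r
    proof (cases "y \<in> S")
      case True
      have "r \<le> \<rho> y" using \<rho>_attained[OF \<open>y \<in> F\<close>] r by force
      then have "\<forall>u\<in>cball y r. \<Phi> u = \<phi> y + A (u - y)"
        using at_S[OF True] by (auto simp: dist_norm norm_minus_commute)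
      then show ?thesis using A by blast
    next
      case False
      then have "y \<in> F'" using \<open>y \<in> F\<close> by (simp add: F'_def)
      \<comment> \<open>The radius is at most an eighth of the distance from y to x, so the ball
        stays outside the region changed at this stage.\<close>
      have \<Phi>_\<Psi>: "\<Phi> u = \<Psi> u" if "u \<in> cball y r" for u
      proof (rule outer)
        have "y \<noteq> x" using False xS by auto
        then have "8 * r \<le> norm (y - x)" using r x(1) by auto
        moreover have "norm (y - x) \<le> norm (u - x) + norm (u - y)"
          using norm_triangle_ineq4[of "u - x" "u - y"] by simp
        moreover have "norm (u - y) \<le> r" using that by (simp add: dist_norm norm_minus_commute)
        ultimately show "l * \<tau> / 2 \<le> norm (u - x)"
          using far[OF \<open>y \<in> F\<close> False] l\<tau> \<tau> by linarith
      qed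
      have "\<forall>z\<in>F' - {y}. 8 * r \<le> norm (y - z)" using r F'(1) by blast
      from \<Psi>_local[OF \<open>y \<in> F'\<close> \<open>r > 0\<close> this] obtain A0
        where "orthogonal_transformation A0" "det (matrix A0) = s" "\<forall>u\<in>cball y r. \<Psi> u = \<phi> y + A0 (u - y)"
        by (elim exE conjE)
      then show ?thesis using \<Phi>_\<Psi> by (intro exI[of _ A0] conjI ballI) auto
    qed
    show ?thesis
      by (rule exI[of _ \<Phi>], intro conjI ballI allI impI) (fact \<Phi>, erule \<Phi>_eq, erule (2) \<Phi>_local)
  qed
qed

section \<open>Choice of the constants\<close>

theorem theorem1p12:
  fixes k :: nat
  assumes "CARD('n::finite) \<ge> 2" and "k \<ge> 1"
  shows "\<exists>c C'. c > 0 \<and> C' > 0 \<and>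
    (\<forall>(E :: (real^'n) set) (\<phi> :: real^'n \<Rightarrow> real^'n) \<epsilon>.
       finite E \<longrightarrow> card E \<le> k \<longrightarrow> 0 < \<epsilon> \<longrightarrow> \<epsilon> < c \<longrightarrow>
       (\<forall>E0 \<subseteq> E. card E0 \<le> 2 * CARD('n) + 2 \<longrightarrow>
          (\<exists>\<Psi>. distorted_diffeo (exp (- C' / \<epsilon>)) \<Psi> \<and> (\<forall>x\<in>E0. \<Psi> x = \<phi> x))) \<longrightarrow>
       (\<exists>\<Phi>. distorted_diffeo \<epsilon> \<Phi> \<and> (\<forall>x\<in>E. \<Phi> x = \<phi> x)))"
proof -
  obtain C where "C \<ge> 1" and motions: "\<forall>\<delta> \<Lambda> \<theta> E (\<phi> :: real^'n \<Rightarrow> real^'n). 0 < \<delta> \<longrightarrow> C * \<delta> \<le> 1 \<longrightarrow>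
     1 \<le> \<Lambda> \<longrightarrow> 0 \<le> \<theta> \<longrightarrow> C * sqrt \<delta> * \<Lambda>\<^sup>2 \<le> \<theta>\<^sup>2 \<longrightarrow> finite E \<longrightarrow>
     (\<forall>E0\<subseteq>E. card E0 \<le> 2 * CARD('n) + 2 \<longrightarrow> (\<exists>f. near_isometric_on \<delta> UNIV f \<and> (\<forall>x\<in>E0. f x = \<phi> x))) \<longrightarrow>
     approx_motions \<phi> E 1 \<Lambda> \<theta> \<or> approx_motions \<phi> E (- 1) \<Lambda> \<theta>"
    using approx_motions_exist[where ?'n = 'n] by (elim exE conjE) (rule that, assumption, assumption)
  define N where "N = real ((CARD('n) + 1) * k)"
  have "1 * 1 \<le> (CARD('n) + 1) * k" using assms by (intro mult_le_mono) auto
  then have "real 1 \<le> real ((CARD('n) + 1) * k)" by (intro of_nat_mono) simp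
  then have N: "N \<ge> 1" by (simp only: N_def of_nat_1)
  have k: "real k \<ge> 1" using assms by simp
  \<comment> \<open>Collects everything independent of \<epsilon> in the requirement
    \<open>C * sqrt \<delta> * \<Lambda>\<^sup>2 \<le> \<theta>\<^sup>2\<close>.\<close>
  define M where "M = C * (4 * (32 ^ k)\<^sup>2 * (128 * N * k)\<^sup>2)"
  have "1 \<le> 128 * N * real k"
    using mult_mono[of 1 "128 * N" 1 "real k"] N k by simp
  then have "1 \<le> (128 * N * real k)\<^sup>2" by (rule one_le_power)
  moreover have "(1::real) \<le> (32 ^ k)\<^sup>2" by (intro one_le_power) auto
  ultimately have "1 * 1 \<le> 4 * (32 ^ k)\<^sup>2 * (128 * N * real k)\<^sup>2"
    by (intro mult_mono) linarith+
  then have "C * 1 \<le> M"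
    unfolding M_def using \<open>C \<ge> 1\<close> by (intro mult_left_mono) auto
  then have "C \<le> M" by simp
  \<comment> \<open>The outer factor 2 compensates the square root of \<delta>. The summands pay for
    the constant M, for \<open>(exp b ^ k)\<^sup>2\<close> with b = 1024 * N / \<epsilon>, and for
    the factor \<open>1 / \<epsilon>\<^sup>2\<close> coming from \<theta>.\<close>
  define C' where "C' = 2 * (M + 2048 * N * k + 2)"
  have Nk: "0 \<le> N * real k" using N by simp
  show ?thesis
  proof (rule exI[of _ 1], rule exI[of _ C'], intro conjI allI impI)
    show "C' > 0" using \<open>C \<le> M\<close> \<open>C \<ge> 1\<close> Nk by (simp add: C'_def)
    fix E :: "(real^'n) set" and \<phi> :: "real^'n \<Rightarrow> real^'n" and \<epsilon> :: real
    assume E: "finite E" "card E \<le> k" and \<epsilon>: "0 < \<epsilon>" "\<epsilon> < 1"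
      and ext: "\<forall>E0 \<subseteq> E. card E0 \<le> 2 * CARD('n) + 2 \<longrightarrow>
          (\<exists>\<Psi>. distorted_diffeo (exp (- C' / \<epsilon>)) \<Psi> \<and> (\<forall>x\<in>E0. \<Psi> x = \<phi> x))"
    show "\<exists>\<Phi>. distorted_diffeo \<epsilon> \<Phi> \<and> (\<forall>x\<in>E. \<Phi> x = \<phi> x)"
    proof (cases "E = {}")
      case True
      have "almost_isometric_diffeo (1 + \<epsilon>) (\<lambda>x :: real^'n. 0 + (x - 0))"
        using \<epsilon> by (intro almost_isometric_diffeo_mono[OF
              almost_isometric_diffeo_isometry[OF orthogonal_transformation_id]]) auto
      then show ?thesis
        using almost_isometric_diffeo_imp_distorted \<epsilon> True by blast
    next
      case False
      define \<delta> where "\<delta> = exp (- C' / \<epsilon>)"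
      \<comment> \<open>At most N factors 1 + \<eta> accumulate, and their product is at most exp
        (\<epsilon> / 2), hence at most 1 + \<epsilon>.\<close>
      define \<eta> where "\<eta> = \<epsilon> / (2 * N)"
      have \<eta>: "0 < \<eta>" "\<eta> \<le> 1" using \<epsilon> N by (simp_all add: \<eta>_def)
      define b where "b = 512 / \<eta>"
      have b: "b = 1024 * N / \<epsilon>" by (simp add: b_def \<eta>_def)
      define \<Lambda> where "\<Lambda> = 2 * (32 * exp b) ^ k"
      define \<theta> where "\<theta> = \<eta> / (64 * k)"
      have "b > 0" using \<epsilon> N by (simp add: b)
      have le_exp: "z \<le> exp (z / \<epsilon>)" if "z \<ge> 0" for z
      proof -
        have "z * 1 \<le> z * (1 / \<epsilon>)" using that \<epsilon> by (intro mult_left_mono) auto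
        then have "z \<le> z / \<epsilon>" by simp
        then show ?thesis using exp_ge_add_one_self[of "z / \<epsilon>"] by linarith
      qed
      have "C * \<delta> \<le> exp (C' / \<epsilon>) * \<delta>"
      proof -
        have "C \<le> C'" using \<open>C \<le> M\<close> \<open>C \<ge> 1\<close> Nk by (simp add: C'_def)
        then show ?thesis
          using le_exp[of C'] \<open>C \<ge> 1\<close> by (intro mult_right_mono) (auto simp: \<delta>_def)
      qed
      then have "C * \<delta> \<le> 1" by (simp add: \<delta>_def flip: exp_add)
      have "1 \<le> (32 * exp b) ^ k"
        using \<open>b > 0\<close> by (intro one_le_power) (simp add: order_trans[OF _ mult_left_mono[of 1]])
      then have "1 \<le> \<Lambda>" by (simp add: \<Lambda>_def)
      have \<theta>: "\<theta> = \<epsilon> / (128 * N * k)" by (simp add: \<theta>_def \<eta>_def)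
      have "C * sqrt \<delta> * \<Lambda>\<^sup>2 \<le> \<theta>\<^sup>2"
      proof -
        \<comment> \<open>Turns the polynomial loss in 1 / \<epsilon> into an exponential that the
          choice of \<delta> can absorb.\<close>
        have "1 / \<epsilon> \<le> exp (1 / \<epsilon>)" using exp_ge_add_one_self[of "1 / \<epsilon>"] by linarith
        then have "1 \<le> \<epsilon> * exp (1 / \<epsilon>)" using \<epsilon> by (simp add: field_simps)
        then have "1 \<le> (\<epsilon> * exp (1 / \<epsilon>))\<^sup>2" by (rule one_le_power)
        then have \<epsilon>_sq: "1 \<le> \<epsilon>\<^sup>2 * exp (2 / \<epsilon>)"
          by (simp add: power_mult_distrib flip: exp_double)
        have "\<Lambda>\<^sup>2 = 4 * (32 ^ k)\<^sup>2 * (exp b ^ k)\<^sup>2"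
          by (simp add: \<Lambda>_def power_mult_distrib)
        also have "(exp b ^ k)\<^sup>2 = exp (2048 * N * k / \<epsilon>)"
          by (simp add: b flip: exp_of_nat_mult exp_double)
        finally have "C * \<Lambda>\<^sup>2 * (128 * N * k)\<^sup>2 = M * exp (2048 * N * k / \<epsilon>)"
          by (simp add: M_def)
        also have "\<dots> \<le> exp (M / \<epsilon>) * exp (2048 * N * k / \<epsilon>)"
          using le_exp[of M] \<open>C \<le> M\<close> \<open>C \<ge> 1\<close> by (intro mult_right_mono) auto
        also have "\<dots> * 1 \<le> exp (M / \<epsilon>) * exp (2048 * N * k / \<epsilon>) * (\<epsilon>\<^sup>2 * exp (2 / \<epsilon>))"
          using \<epsilon>_sq by (intro mult_left_mono) auto
        also have "\<dots> = \<epsilon>\<^sup>2 * exp (C' / \<epsilon> / 2)"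
          by (simp add: C'_def add_divide_distrib flip: exp_add)
        finally have "C * \<Lambda>\<^sup>2 * (128 * N * k)\<^sup>2 \<le> \<epsilon>\<^sup>2 * exp (C' / \<epsilon> / 2)" by simp
        then have "sqrt \<delta> * (C * \<Lambda>\<^sup>2 * (128 * N * k)\<^sup>2) \<le> sqrt \<delta> * (\<epsilon>\<^sup>2 * exp (C' / \<epsilon> / 2))"
          by (intro mult_left_mono) (auto simp: \<delta>_def)
        also have "sqrt \<delta> = exp (- (C' / \<epsilon> / 2))"
          by (rule real_sqrt_unique) (simp_all add: \<delta>_def flip: exp_double)
        then have "sqrt \<delta> * (\<epsilon>\<^sup>2 * exp (C' / \<epsilon> / 2)) = \<epsilon>\<^sup>2"
          by (simp add: exp_minus)
        finally have "C * sqrt \<delta> * \<Lambda>\<^sup>2 * (128 * N * k)\<^sup>2 \<le> \<epsilon>\<^sup>2" by (simp add: mult_ac)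
        moreover have "(128 * N * k)\<^sup>2 > 0" using N k by simp
        ultimately show ?thesis unfolding \<theta> by (simp add: power_divide pos_le_divide_eq)
      qed
      moreover have "\<forall>E0\<subseteq>E. card E0 \<le> 2 * CARD('n) + 2 \<longrightarrow>
          (\<exists>f. near_isometric_on \<delta> UNIV f \<and> (\<forall>x\<in>E0. f x = \<phi> x))"
      proof (intro allI impI)
        fix E0 assume "E0 \<subseteq> E" "card E0 \<le> 2 * CARD('n) + 2"
        then obtain \<Psi> where "distorted_diffeo \<delta> \<Psi>" "\<forall>x\<in>E0. \<Psi> x = \<phi> x"
          using ext unfolding \<delta>_def by blast
        moreover from distorted_diffeo_bilipschitz[OF this(1)] have "near_isometric_on \<delta> UNIV \<Psi>"
          by (simp add: near_isometric_on_def \<delta>_def)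
        ultimately show "\<exists>f. near_isometric_on \<delta> UNIV f \<and> (\<forall>x\<in>E0. f x = \<phi> x)" by blast
      qed
      moreover have "\<delta> > 0" "\<theta> \<ge> 0" using \<eta> by (simp_all add: \<delta>_def \<theta>_def)
      ultimately have "approx_motions \<phi> E 1 \<Lambda> \<theta> \<or> approx_motions \<phi> E (- 1) \<Lambda> \<theta>"
        using motions \<open>C * \<delta> \<le> 1\<close> \<open>1 \<le> \<Lambda>\<close> E(1) by blast
      then obtain s where s: "approx_motions \<phi> E s \<Lambda> \<theta>" "s \<noteq> 0" by force
      obtain \<Phi> where \<Phi>: "almost_isometric_diffeo ((1 + \<eta>) ^ ((CARD('n) + 1) * card E)) \<Phi>"
        "\<forall>x\<in>E. \<Phi> x = \<phi> x"
        using extension_by_clusters[OF E \<eta> _ s(1)[unfolded \<Lambda>_def \<theta>_def] s(2) subset_refl False]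
        by (auto simp: b_def)
      have "(1 + \<eta>) ^ ((CARD('n) + 1) * card E) \<le> (1 + \<eta>) ^ ((CARD('n) + 1) * k)"
        using \<eta> E by (intro power_increasing mult_le_mono2) auto
      also have "\<dots> \<le> exp \<eta> ^ ((CARD('n) + 1) * k)"
        using \<eta> by (intro power_mono exp_ge_add_one_self) auto
      also have "\<dots> = exp (N * \<eta>)" unfolding N_def by (rule exp_of_nat_mult[symmetric])
      also have "N * \<eta> = \<epsilon> / 2" using N by (simp add: \<eta>_def)
      also have "exp (\<epsilon> / 2) \<le> 1 + \<epsilon> / 2 + (\<epsilon> / 2)\<^sup>2" using \<epsilon> by (intro exp_bound) auto
      also have "(\<epsilon> / 2)\<^sup>2 \<le> \<epsilon> / 2"
        using \<epsilon> mult_left_le[of "\<epsilon> / 2" "\<epsilon> / 2"] by (simp add: power2_eq_square)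
      finally have "(1 + \<eta>) ^ ((CARD('n) + 1) * card E) \<le> 1 + \<epsilon>" by simp
      then have "distorted_diffeo \<epsilon> \<Phi>"
        using almost_isometric_diffeo_imp_distorted[OF almost_isometric_diffeo_mono[OF \<Phi>(1)]] \<epsilon> by simp
      then show ?thesis using \<Phi>(2) by blast
    qed
  qed simp
qed

end
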